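(* Let $p$ be a prime and let $(R,\mathfrak{m})$ be a commutative Noetherian local ring of characteristic $p$. Then $R$ is $F$-pure if and only if the $R$-module structure on the injective envelope $E_R(R/\mathfrak{m})$ can be extended to a structure of $x$-torsion-free left $R[x,f]$-module.
   Context: Let $R$ be a commutative Noetherian ring of prime characteristic $p$ and $f:R\to R$, $f(r)=r^p$, the Frobenius homomorphism. The Frobenius skew polynomial ring $R[x,f]$ is freely generated as a left $R$-module by $(x^i)_{i\ge 0}$, with multiplication subject to $xr=r^px$ for all $r\in R$. The component $Rx$ is an $(R,R)$-bimodule (left structure natural; right structure $rx\cdot r' = r r'^{p}x$). $R$ is $F$-pure if, for each $R$-module $N$, the map $N\to Rx\otimes_R N$, $g\mapsto x\otimes g$, is injective. A left $R[x,f]$-module $H$ is $x$-torsion-free if $\Gamma_x(H):=\{h\in H: x^nh=0 \text{ for some } n\ge 1\}=0$. *)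

theory Defs
  imports "HOL-Algebra.UnivPoly" "HOL-Algebra.QuotRing" "HOL-Algebra.Ring_Divisibility"
    "HOL-Algebra.Free_Abelian_Groups" "HOL-Computational_Algebra.Primes"
begin

text \<open>
  HOL cannot quantify over all types inside a formula. Notions that refer to
  ``every \<open>R\<close>-module'' therefore take a type argument \<open>TYPE('u)\<close>, the universe, and range over all
  modules whose carrier is a set of elements of \<open>'u\<close>. At a sum type \<open>'a + 'e + 'n\<close> they cover, up to
  isomorphism, the ring \<open>R\<close> with its ideals (type \<open>'a\<close>), a given module of type \<open>'e\<close>, and all modules
  of the arbitrary type \<open>'n\<close>. For injectivity nothing is lost by bounding the universe once it contains
  a copy of \<open>'a\<close>, by Baer's criterion.
\<close>

section \<open>Local rings and characteristic\<close>

definition noetherian_local_ring :: "('a, 'r) ring_scheme \<Rightarrow> 'a set \<Rightarrow> bool" where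
  "noetherian_local_ring R \<mm> \<longleftrightarrow>
     cring R \<and> noetherian_ring R \<and> maximalideal \<mm> R \<and>
     (\<forall>\<nn>. maximalideal \<nn> R \<longrightarrow> \<nn> = \<mm>)"

definition has_characteristic :: "('a, 'r) ring_scheme \<Rightarrow> nat \<Rightarrow> bool" where
  "has_characteristic R p \<longleftrightarrow> (\<forall>n::nat. [n] \<cdot>\<^bsub>R\<^esub> \<one>\<^bsub>R\<^esub> = \<zero>\<^bsub>R\<^esub> \<longleftrightarrow> p dvd n)"


section \<open>Injective envelopes\<close>

definition module_hom ::
  "('a, 'r) ring_scheme \<Rightarrow> ('a, 'm, 's) module_scheme \<Rightarrow> ('a, 'n, 't) module_scheme \<Rightarrow> ('m \<Rightarrow> 'n) set"
  where "module_hom R M N =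
    {\<phi> \<in> carrier M \<rightarrow> carrier N.
       (\<forall>x\<in>carrier M. \<forall>y\<in>carrier M. \<phi> (x \<oplus>\<^bsub>M\<^esub> y) = \<phi> x \<oplus>\<^bsub>N\<^esub> \<phi> y) \<and>
       (\<forall>r\<in>carrier R. \<forall>x\<in>carrier M. \<phi> (r \<odot>\<^bsub>M\<^esub> x) = r \<odot>\<^bsub>N\<^esub> \<phi> x)}"

definition injective_module ::
  "'u itself \<Rightarrow> ('a, 'r) ring_scheme \<Rightarrow> ('a, 'e) module \<Rightarrow> bool" where
  "injective_module _ R E \<longleftrightarrow> module R E \<and>
     (\<forall>(A :: ('a, 'u) module) (B :: ('a, 'u) module). \<forall>j \<phi>.
        module R A \<and> module R B \<and> j \<in> module_hom R A B \<and> inj_on j (carrier A) \<and>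
        \<phi> \<in> module_hom R A E \<longrightarrow>
        (\<exists>\<psi>\<in>module_hom R B E. \<forall>a\<in>carrier A. \<psi> (j a) = \<phi> a))"

definition essential_embedding ::
  "('a, 'r) ring_scheme \<Rightarrow> ('a, 'k) module \<Rightarrow> ('a, 'e) module \<Rightarrow> ('k \<Rightarrow> 'e) \<Rightarrow> bool" where
  "essential_embedding R K E \<iota> \<longleftrightarrow>
     \<iota> \<in> module_hom R K E \<and> inj_on \<iota> (carrier K) \<and>
     (\<forall>L. submodule L R E \<and> L \<noteq> {\<zero>\<^bsub>E\<^esub>} \<longrightarrow> L \<inter> \<iota> ` carrier K \<noteq> {\<zero>\<^bsub>E\<^esub>})"

text \<open>\<open>(E, \<iota>)\<close> is an injective envelope of \<open>K\<close>.\<close>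

definition injective_envelope ::
  "'u itself \<Rightarrow> ('a, 'r) ring_scheme \<Rightarrow> ('a, 'k) module \<Rightarrow> ('a, 'e) module \<Rightarrow> ('k \<Rightarrow> 'e) \<Rightarrow> bool"
  where "injective_envelope U R K E \<iota> \<longleftrightarrow>
    module R K \<and> injective_module U R E \<and> essential_embedding R K E \<iota>"

definition quotient_module :: "('a, 'r) ring_scheme \<Rightarrow> 'a set \<Rightarrow> ('a, 'a set) module" where
  "quotient_module R I =
     ring.extend (R Quot I) (module.fields (\<lambda>r c. (I +>\<^bsub>R\<^esub> r) \<otimes>\<^bsub>R Quot I\<^esub> c))"


section \<open>The Frobenius skew polynomial ring\<close>

text \<open>
  The function \<open>a \<in> up R\<close> stands for the left-hand sum \<open>\<Sum>i. a i x\<^sup>i\<close>. The product comes from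
  \<open>(r x\<^sup>i) (s x\<^sup>j) = r s\<^bsup>p^i\<^esup> x\<^bsup>i+j\<^esup>\<close>, which is what \<open>x r = r\<^sup>p x\<close> forces.
\<close>

definition frob_skew_poly :: "('a, 'r) ring_scheme \<Rightarrow> nat \<Rightarrow> (nat \<Rightarrow> 'a) ring" where
  "frob_skew_poly R p = \<lparr>
     carrier = up R,
     monoid.mult = (\<lambda>a b n. \<Oplus>\<^bsub>R\<^esub>i\<in>{..n}. a i \<otimes>\<^bsub>R\<^esub> (b (n - i) [^]\<^bsub>R\<^esub> (p ^ i))),
     monoid.one = (\<lambda>i. if i = 0 then \<one>\<^bsub>R\<^esub> else \<zero>\<^bsub>R\<^esub>),
     ring.zero = (\<lambda>i. \<zero>\<^bsub>R\<^esub>),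
     ring.add = (\<lambda>a b i. a i \<oplus>\<^bsub>R\<^esub> b i)\<rparr>"

text \<open>\<open>skew_monom R r n\<close> is \<open>r x\<^sup>n\<close>.\<close>

definition skew_monom :: "('a, 'r) ring_scheme \<Rightarrow> 'a \<Rightarrow> nat \<Rightarrow> nat \<Rightarrow> 'a" where
  "skew_monom R r n = (\<lambda>i. if i = n then r else \<zero>\<^bsub>R\<^esub>)"

abbreviation skew_X :: "('a, 'r) ring_scheme \<Rightarrow> nat \<Rightarrow> 'a" where
  "skew_X R \<equiv> skew_monom R \<one>\<^bsub>R\<^esub> 1"

lemma (in cring) skew_monom_mult:
  assumes "r \<in> carrier R" "s \<in> carrier R" "p > 0"
  shows "skew_monom R r i \<otimes>\<^bsub>frob_skew_poly R p\<^esub> skew_monom R s j =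
         skew_monom R (r \<otimes> s [^] (p ^ i)) (i + j)"
proof
  fix n
  have z: "\<zero> [^] (p ^ k) = \<zero>" for k
    using assms(3) by (simp add: nat_pow_zero)
  have "(skew_monom R r i \<otimes>\<^bsub>frob_skew_poly R p\<^esub> skew_monom R s j) n =
      (\<Oplus>k\<in>{..n}. skew_monom R r i k \<otimes> (skew_monom R s j (n - k) [^] (p ^ k)))"
    by (simp add: frob_skew_poly_def)
  also have "\<dots> =
      (\<Oplus>k\<in>{..n}. if i = k then (if n = i + j then r \<otimes> s [^] (p ^ i) else \<zero>) else \<zero>)"
    by (rule finsum_cong') (auto simp: skew_monom_def assms z)
  also have "\<dots> = skew_monom R (r \<otimes> s [^] (p ^ i)) (i + j) n"
  proof (cases "i \<le> n")
    case True
    then show ?thesis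
      using assms finsum_singleton[of i "{..n}" "\<lambda>_. if n = i + j then r \<otimes> s [^] (p ^ i) else \<zero>"]
      by (simp add: skew_monom_def Pi_def)
  next
    case False
    then have "(\<Oplus>k\<in>{..n}. if i = k then (if n = i + j then r \<otimes> s [^] (p ^ i) else \<zero>) else \<zero>)
        = (\<Oplus>k\<in>{..n}. \<zero>)"
      by (intro finsum_cong') auto
    with False show ?thesis by (simp add: skew_monom_def)
  qed
  finally show "(skew_monom R r i \<otimes>\<^bsub>frob_skew_poly R p\<^esub> skew_monom R s j) n =
      skew_monom R (r \<otimes> s [^] (p ^ i)) (i + j) n" .
qed

text \<open>The locale \<^locale>\<open>module\<close> is restricted to commutative base rings.\<close>

locale left_module = S?: ring S + M?: abelian_group M
  for S :: "('s, 'r) ring_scheme" (structure) and M :: "('s, 'h, 'm) module_scheme" (structure) +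
  assumes smult_closed:
      "\<lbrakk> a \<in> carrier S; x \<in> carrier M \<rbrakk> \<Longrightarrow> a \<odot>\<^bsub>M\<^esub> x \<in> carrier M"
    and smult_l_distr:
      "\<lbrakk> a \<in> carrier S; b \<in> carrier S; x \<in> carrier M \<rbrakk> \<Longrightarrow>
       (a \<oplus> b) \<odot>\<^bsub>M\<^esub> x = a \<odot>\<^bsub>M\<^esub> x \<oplus>\<^bsub>M\<^esub> b \<odot>\<^bsub>M\<^esub> x"
    and smult_r_distr:
      "\<lbrakk> a \<in> carrier S; x \<in> carrier M; y \<in> carrier M \<rbrakk> \<Longrightarrow>
       a \<odot>\<^bsub>M\<^esub> (x \<oplus>\<^bsub>M\<^esub> y) = a \<odot>\<^bsub>M\<^esub> x \<oplus>\<^bsub>M\<^esub> a \<odot>\<^bsub>M\<^esub> y"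
    and smult_assoc:
      "\<lbrakk> a \<in> carrier S; b \<in> carrier S; x \<in> carrier M \<rbrakk> \<Longrightarrow>
       (a \<otimes> b) \<odot>\<^bsub>M\<^esub> x = a \<odot>\<^bsub>M\<^esub> (b \<odot>\<^bsub>M\<^esub> x)"
    and smult_one:
      "x \<in> carrier M \<Longrightarrow> \<one> \<odot>\<^bsub>M\<^esub> x = x"

definition x_torsion :: "('a, 'r) ring_scheme \<Rightarrow> nat \<Rightarrow> (nat \<Rightarrow> 'a, 'h) module \<Rightarrow> 'h set" where
  "x_torsion R p H =
     {h \<in> carrier H. \<exists>n::nat. n \<ge> 1 \<and>
        (skew_X R [^]\<^bsub>frob_skew_poly R p\<^esub> n) \<odot>\<^bsub>H\<^esub> h = \<zero>\<^bsub>H\<^esub>}"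

definition x_torsion_free :: "('a, 'r) ring_scheme \<Rightarrow> nat \<Rightarrow> (nat \<Rightarrow> 'a, 'h) module \<Rightarrow> bool" where
  "x_torsion_free R p H \<longleftrightarrow> x_torsion R p H = {\<zero>\<^bsub>H\<^esub>}"

text \<open>
  \<open>H\<close> extends the \<open>R\<close>-module \<open>E\<close>: same underlying additive group, and \<open>r x\<^sup>0\<close> acts on \<open>H\<close> as \<open>r\<close>
  acts on \<open>E\<close>.
\<close>

definition extends_to_skew_module ::
  "('a, 'r) ring_scheme \<Rightarrow> nat \<Rightarrow> ('a, 'e) module \<Rightarrow> (nat \<Rightarrow> 'a, 'e) module \<Rightarrow> bool" where
  "extends_to_skew_module R p E H \<longleftrightarrow>
     left_module (frob_skew_poly R p) H \<and>
     carrier H = carrier E \<and> \<zero>\<^bsub>H\<^esub> = \<zero>\<^bsub>E\<^esub> \<and>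
     (\<forall>g\<in>carrier E. \<forall>h\<in>carrier E. g \<oplus>\<^bsub>H\<^esub> h = g \<oplus>\<^bsub>E\<^esub> h) \<and>
     (\<forall>r\<in>carrier R. \<forall>h\<in>carrier E. skew_monom R r 0 \<odot>\<^bsub>H\<^esub> h = r \<odot>\<^bsub>E\<^esub> h)"


section \<open>Tensor products and F-purity\<close>

text \<open>
  The tensor product over the commutative ring \<open>R\<close>, as an abelian group: the free abelian group on
  \<open>M \<times> N\<close> modulo the usual relations. In the first argument \<open>r \<odot> m\<close> plays the role of the right
  action \<open>m \<cdot> r\<close>.
\<close>

definition tensor_relations ::
  "('a, 'r) ring_scheme \<Rightarrow> ('a, 'm) module \<Rightarrow> ('a, 'n) module \<Rightarrow> ('m \<times> 'n \<Rightarrow>\<^sub>0 int) set" where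
  "tensor_relations R M N =
     {frag_of (m \<oplus>\<^bsub>M\<^esub> m', n) - frag_of (m, n) - frag_of (m', n) | m m' n.
        m \<in> carrier M \<and> m' \<in> carrier M \<and> n \<in> carrier N} \<union>
     {frag_of (m, n \<oplus>\<^bsub>N\<^esub> n') - frag_of (m, n) - frag_of (m, n') | m n n'.
        m \<in> carrier M \<and> n \<in> carrier N \<and> n' \<in> carrier N} \<union>
     {frag_of (r \<odot>\<^bsub>M\<^esub> m, n) - frag_of (m, r \<odot>\<^bsub>N\<^esub> n) | r m n.
        r \<in> carrier R \<and> m \<in> carrier M \<and> n \<in> carrier N}"

definition tensor_relation_subgroup ::
  "('a, 'r) ring_scheme \<Rightarrow> ('a, 'm) module \<Rightarrow> ('a, 'n) module \<Rightarrow> ('m \<times> 'n \<Rightarrow>\<^sub>0 int) set" where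
  "tensor_relation_subgroup R M N =
     generate (free_Abelian_group (carrier M \<times> carrier N)) (tensor_relations R M N)"

definition tensor_product ::
  "('a, 'r) ring_scheme \<Rightarrow> ('a, 'm) module \<Rightarrow> ('a, 'n) module \<Rightarrow> ('m \<times> 'n \<Rightarrow>\<^sub>0 int) set monoid"
  where "tensor_product R M N =
    free_Abelian_group (carrier M \<times> carrier N) Mod tensor_relation_subgroup R M N"

definition pure_tensor ::
  "('a, 'r) ring_scheme \<Rightarrow> ('a, 'm) module \<Rightarrow> ('a, 'n) module \<Rightarrow> 'm \<Rightarrow> 'n \<Rightarrow> ('m \<times> 'n \<Rightarrow>\<^sub>0 int) set"
  where "pure_tensor R M N m n =
    tensor_relation_subgroup R M N
      #>\<^bsub>free_Abelian_group (carrier M \<times> carrier N)\<^esub> frag_of (m, n)"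

text \<open>
  The component \<open>R x\<close> of \<open>R[x,f]\<close> with its right \<open>R\<close>-module structure, \<open>(r x) \<cdot> s\<close> being the product
  \<open>(r x) (s x\<^sup>0) = r s\<^sup>p x\<close> in \<open>R[x,f]\<close>; only this structure enters \<open>R x \<otimes> N\<close> as a group.
\<close>

definition frob_bimodule_right :: "('a, 'r) ring_scheme \<Rightarrow> nat \<Rightarrow> ('a, nat \<Rightarrow> 'a) module" where
  "frob_bimodule_right R p =
     ring.extend ((frob_skew_poly R p)\<lparr>carrier := (\<lambda>r. skew_monom R r 1) ` carrier R\<rparr>)
       (module.fields (\<lambda>s h. h \<otimes>\<^bsub>frob_skew_poly R p\<^esub> skew_monom R s 0))"

definition F_pure :: "'u itself \<Rightarrow> ('a, 'r) ring_scheme \<Rightarrow> nat \<Rightarrow> bool" where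
  "F_pure _ R p \<longleftrightarrow>
     (\<forall>N :: ('a, 'u) module. module R N \<longrightarrow>
        inj_on (pure_tensor R (frob_bimodule_right R p) N (skew_X R)) (carrier N))"

end

theory Submission
  imports Defs
begin

text \<open>
  Let \<open>u \<in> E\<close> be the image of \<open>1 \<in> R/\<mm>\<close>. It is killed by \<open>\<mm>\<close> and lies in every nonzero submodule
  of \<open>E\<close>; since \<open>E\<close> is injective, every nonzero element \<open>g\<close> of every module \<open>N\<close> is sent to \<open>u\<close> by
  some homomorphism \<open>N \<rightarrow> E\<close>. Extending the module structure of \<open>E\<close> to \<open>R[x,f]\<close> amounts to
  choosing an additive \<open>X : E \<rightarrow> E\<close> with \<open>X (r e) = r\<^sup>p X e\<close>, and \<open>x\<close>-torsion-freeness means that \<open>X\<close>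
  is injective.

  Given an injective \<open>X\<close> and \<open>g \<noteq> 0\<close> in \<open>N\<close>, take \<open>\<phi> : N \<rightarrow> E\<close> with \<open>\<phi> g \<noteq> 0\<close>; the map
  \<open>r x \<otimes> n \<mapsto> r X (\<phi> n)\<close> shows \<open>x \<otimes> g \<noteq> 0\<close>. Conversely, if \<open>R\<close> is \<open>F\<close>-pure then \<open>x \<otimes> u \<noteq> 0\<close>, so
  some \<open>R\<close>-linear \<open>\<psi> : Rx \<otimes> E \<rightarrow> E\<close> sends \<open>x \<otimes> u\<close> to \<open>u\<close>. Then \<open>X e = \<psi> (x \<otimes> e)\<close> has
  a submodule of \<open>E\<close> as kernel, and this does not contain \<open>u\<close>, so it is \<open>0\<close>.

  The module \<open>Rx \<otimes> E\<close> need not fit into the universe in which \<open>E\<close> is assumed to be injective;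
  Baer's criterion removes this restriction.
\<close>

section \<open>The Frobenius map\<close>

context cring
begin

text \<open>Induction on \<open>n\<close>: Pascal's rule splits the sum for \<open>Suc n\<close>
  into two sums, which are the expansion for \<open>n\<close> multiplied by \<open>x\<close> and by
  \<open>y\<close>.\<close>

lemma binomial_ring:
  assumes x: "x \<in> carrier R" and y: "y \<in> carrier R"
  shows "(x \<oplus> y) [^] (n::nat) = (\<Oplus>k\<in>{..n}. [(n choose k)] \<cdot> (x [^] k \<otimes> y [^] (n - k)))"
proof (induction n)
  case 0
  then show ?case by (simp add: Pi_def)
next
  case (Suc n)
  define t where "t i j = x [^] i \<otimes> y [^] j" for i j :: nat
  have tc [simp]: "t i j \<in> carrier R" for i j
    using x y by (simp add: t_def)
  have tx: "t i j \<otimes> x = t (Suc i) j" and ty: "t i j \<otimes> y = t i (Suc j)" for i j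
    using x y by (simp_all add: t_def m_ac)
  have ap: "([m] \<cdot> (t i j)) \<otimes> z = [m] \<cdot> (t i j \<otimes> z)" if "z \<in> carrier R" for m i j :: nat and z
    using add_pow_ldistr that by simp
  have zero_pow: "[(0::nat)] \<cdot> z = \<zero>" for z
    by (simp add: add_pow_def)
  have "(\<Oplus>k\<in>{..Suc n}. [(Suc n choose k)] \<cdot> (t k (Suc n - k)))
      = (\<Oplus>k\<in>{..n}. [(Suc n choose Suc k)] \<cdot> (t (Suc k) (n - k))) \<oplus> t 0 (Suc n)"
    by (subst finsum_Suc2) simp_all
  also have "(\<Oplus>k\<in>{..n}. [(Suc n choose Suc k)] \<cdot> (t (Suc k) (n - k)))
      = (\<Oplus>k\<in>{..n}. [(n choose k)] \<cdot> (t (Suc k) (n - k)))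
        \<oplus> (\<Oplus>k\<in>{..n}. [(n choose Suc k)] \<cdot> (t (Suc k) (n - k)))"
    by (simp add: Pi_def add.nat_pow_mult [symmetric] flip: finsum_addf)
  \<comment> \<open>After the index of the second sum is shifted back, the isolated
    \<open>t 0 (Suc n)\<close> becomes its term at \<open>k = 0\<close>.\<close>
  also have "\<dots> \<oplus> t 0 (Suc n) = (\<Oplus>k\<in>{..n}. [(n choose k)] \<cdot> (t (Suc k) (n - k)))
        \<oplus> (\<Oplus>k\<in>{..Suc n}. [(n choose k)] \<cdot> (t k (Suc n - k)))"
    by (simp add: finsum_Suc2 a_assoc finsum_closed Pi_def del: finsum_Suc)
  \<comment> \<open>The top term vanishes because \<open>n choose Suc n\<close> is 0.\<close>
  also have "(\<Oplus>k\<in>{..Suc n}. [(n choose k)] \<cdot> (t k (Suc n - k)))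
      = (\<Oplus>k\<in>{..n}. [(n choose k)] \<cdot> (t k (Suc n - k)))"
    by (subst finsum_Suc) (simp_all add: finsum_closed Pi_def zero_pow binomial_eq_0)
  also have "\<dots> = (\<Oplus>k\<in>{..n}. [(n choose k)] \<cdot> (t k (n - k))) \<otimes> y"
    by (subst finsum_ldistr) (auto simp: Pi_def y ap ty Suc_diff_le intro!: finsum_cong')
  also have "(\<Oplus>k\<in>{..n}. [(n choose k)] \<cdot> (t (Suc k) (n - k)))
      = (\<Oplus>k\<in>{..n}. [(n choose k)] \<cdot> (t k (n - k))) \<otimes> x"
    by (subst finsum_ldistr) (auto simp: Pi_def x ap tx intro!: finsum_cong')
  finally show ?case
    using Suc.IH x y by (simp add: t_def r_distr finsum_closed Pi_def)
qed

text \<open>For 0 < k < p the prime \<open>p\<close> divides \<open>p choose k\<close>, and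
  multiples of \<open>p\<close> annihilate a ring of characteristic \<open>p\<close>; only the two
  extreme binomial terms survive.\<close>

lemma frobenius_add:
  assumes p: "normalization_semidom_class.prime p" and char: "has_characteristic R p"
    and x: "x \<in> carrier R" and y: "y \<in> carrier R"
  shows "(x \<oplus> y) [^] p = x [^] p \<oplus> y [^] p"
proof -
  have kill: "[m] \<cdot> z = \<zero>" if "p dvd m" "z \<in> carrier R" for m :: nat and z
  proof -
    have "[m] \<cdot> \<one> = \<zero>"
      using that(1) char by (simp add: has_characteristic_def)
    moreover have "[m] \<cdot> z = ([m] \<cdot> \<one>) \<otimes> z"
      using that(2) by (simp add: add_pow_ldistr)
    ultimately show ?thesis using that(2) by simp
  qed
  obtain q where q: "p = Suc q"
    using prime_gt_0_nat [OF p] gr0_implies_Suc by blast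
  \<comment> \<open>The indices are shifted by one, since the term \<open>y [^] p\<close> will be
    split off; the surviving term \<open>x [^] p\<close> therefore sits at \<open>k = q\<close>, not
    at \<open>k = p\<close>.\<close>
  have inner: "[(p choose Suc k)] \<cdot> (x [^] Suc k \<otimes> y [^] (p - Suc k)) = (if q = k then x [^] p else \<zero>)"
    if "k \<in> {..q}" for k
  proof (cases "k = q")
    case False
    with that p q have "p dvd (p choose Suc k)"
      by (intro dvd_choose_prime) auto
    with False show ?thesis using x y by (simp add: kill)
  qed (use q x in simp)
  have "(x \<oplus> y) [^] p = (\<Oplus>k\<in>{..Suc q}. [(p choose k)] \<cdot> (x [^] k \<otimes> y [^] (p - k)))"
    using binomial_ring [OF x y, of p] q by simp
  also have "\<dots> = (\<Oplus>k\<in>{..q}. [(p choose Suc k)] \<cdot> (x [^] Suc k \<otimes> y [^] (p - Suc k))) \<oplus> y [^] p"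
    using x y by (subst finsum_Suc2) simp_all
  also have "(\<Oplus>k\<in>{..q}. [(p choose Suc k)] \<cdot> (x [^] Suc k \<otimes> y [^] (p - Suc k)))
      = (\<Oplus>k\<in>{..q}. if q = k then x [^] p else \<zero>)"
    using inner x by (intro finsum_cong') auto
  also have "\<dots> = x [^] p"
    using x finsum_singleton [of q "{..q}" "\<lambda>_. x [^] p"] by simp
  finally show ?thesis .
qed

end

text \<open>Both sides sum over the pairs (i, j) with i + j \<le> k, by diagonals and by rows. This
  reindexing gives associativity of the skew product and, later, of its action on modules.\<close>

lemma (in abelian_monoid) finsum_triangle:
  assumes "\<And>i j. f i j \<in> carrier G"
  shows "(\<Oplus>n\<in>{..k::nat}. \<Oplus>i\<in>{..n}. f i (n - i)) = (\<Oplus>i\<in>{..k}. \<Oplus>j\<in>{..k - i}. f i j)"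
proof (induction k)
  case 0
  show ?case using assms by (simp add: Pi_def)
next
  case (Suc k)
  \<comment> \<open>Each old row gains one term on the new diagonal, and the new row
    \<open>i = Suc k\<close> consists of \<open>f (Suc k) 0\<close> alone.\<close>
  have "(\<Oplus>i\<in>{..Suc k}. \<Oplus>j\<in>{..Suc k - i}. f i j)
      = (\<Oplus>i\<in>{..k}. f i (Suc k - i) \<oplus> (\<Oplus>j\<in>{..k - i}. f i j)) \<oplus> f (Suc k) 0"
    using assms by (simp add: Pi_def finsum_closed Suc_diff_le a_comm cong: finsum_cong)
  also have "\<dots> = (\<Oplus>i\<in>{..k}. f i (Suc k - i)) \<oplus> (\<Oplus>i\<in>{..k}. \<Oplus>j\<in>{..k - i}. f i j) \<oplus> f (Suc k) 0"
    using assms by (simp add: Pi_def finsum_closed finsum_addf)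
  also have "\<dots> = (\<Oplus>n\<in>{..Suc k}. \<Oplus>i\<in>{..n}. f i (n - i))"
    using assms Suc.IH by (simp add: Pi_def finsum_closed a_ac)
  finally show ?case by simp
qed

section \<open>The Frobenius skew polynomial ring\<close>

locale frobenius_ring = cring +
  fixes p :: nat
  assumes prime_char: "normalization_semidom_class.prime p"
    and has_char: "has_characteristic R p"
begin

lemma p_pos [simp]: "p > 0"
  using prime_char by (rule prime_gt_0_nat)

lemma zero_pow_frob [simp]: "\<zero> [^] (p ^ i) = \<zero>"
  by (simp add: nat_pow_zero)

lemma frob_pow_add:
  assumes "x \<in> carrier R" "y \<in> carrier R"
  shows "(x \<oplus> y) [^] (p ^ i) = x [^] (p ^ i) \<oplus> y [^] (p ^ i)"
proof (induction i)
  case (Suc i)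
  have pow: "z [^] (p ^ Suc i) = (z [^] (p ^ i)) [^] p" if "z \<in> carrier R" for z
    using that by (simp add: nat_pow_pow mult.commute)
  show ?case
    using assms Suc.IH by (simp add: pow frobenius_add [OF prime_char has_char] del: power_Suc)
qed (use assms in simp)

lemma frob_pow_finsum:
  assumes "f \<in> A \<rightarrow> carrier R"
  shows "(\<Oplus>j\<in>A. f j) [^] (p ^ i) = (\<Oplus>j\<in>A. f j [^] (p ^ i))"
  using assms by (induction A rule: infinite_finite_induct) (auto simp: frob_pow_add Pi_def)

lemma skew_poly_simps:
  "carrier (frob_skew_poly R p) = up R"
  "(a \<otimes>\<^bsub>frob_skew_poly R p\<^esub> b) n = (\<Oplus>i\<in>{..n}. a i \<otimes> b (n - i) [^] (p ^ i))"
  "\<one>\<^bsub>frob_skew_poly R p\<^esub> = (\<lambda>i. if i = 0 then \<one> else \<zero>)"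
  "\<zero>\<^bsub>frob_skew_poly R p\<^esub> = (\<lambda>i. \<zero>)"
  "a \<oplus>\<^bsub>frob_skew_poly R p\<^esub> b = (\<lambda>i. a i \<oplus> b i)"
  by (simp_all add: frob_skew_poly_def)

text \<open>If \<open>a\<close> vanishes above \<open>k\<close> and \<open>b\<close> above
  \<open>l\<close>, then for n > k + l every summand has i > k or n - i > l, so one of its factors
  is zero.\<close>

lemma skew_mult_closed:
  assumes a: "a \<in> up R" and b: "b \<in> up R"
  shows "a \<otimes>\<^bsub>frob_skew_poly R p\<^esub> b \<in> up R"
proof (rule mem_upI)
  show "(a \<otimes>\<^bsub>frob_skew_poly R p\<^esub> b) n \<in> carrier R" for n
    using a b by (auto simp: skew_poly_simps intro!: finsum_closed)
  obtain k l where k: "bound \<zero> k a" and l: "bound \<zero> l b"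
    using a b by blast
  have "(a \<otimes>\<^bsub>frob_skew_poly R p\<^esub> b) n = \<zero>" if "k + l < n" for n
  proof -
    have "a i \<otimes> b (n - i) [^] (p ^ i) = \<zero>" for i
    proof (cases "k < i")
      case True
      then show ?thesis using k b by (simp add: bound.bound mem_upD)
    next
      case False
      then have "l < n - i" using that by simp
      then show ?thesis using l a by (simp add: bound.bound mem_upD)
    qed
    then show ?thesis by (simp add: skew_poly_simps)
  qed
  then show "\<exists>n. bound \<zero> n (a \<otimes>\<^bsub>frob_skew_poly R p\<^esub> b)"
    by blast
qed

text \<open>Either bracketing gives in degree n the sum of \<open>a i \<otimes> b j [^] (p ^ i)
  \<otimes> c m [^] (p ^ (i + j))\<close> over i + j + m = n. On the right-hand side, the power
  \<open>p ^ i\<close> has to pass through the inner sum, which is possible because iterated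
  Frobenius is additive.\<close>

lemma skew_mult_assoc:
  assumes a: "a \<in> up R" and b: "b \<in> up R" and c: "c \<in> up R"
  shows "(a \<otimes>\<^bsub>frob_skew_poly R p\<^esub> b) \<otimes>\<^bsub>frob_skew_poly R p\<^esub> c
       = a \<otimes>\<^bsub>frob_skew_poly R p\<^esub> (b \<otimes>\<^bsub>frob_skew_poly R p\<^esub> c)"
proof
  fix n
  have cl [simp]: "a i \<in> carrier R" "b i \<in> carrier R" "c i \<in> carrier R" for i
    using a b c by auto
  define f where "f i j = a i \<otimes> b j [^] (p ^ i) \<otimes> c (n - (i + j)) [^] (p ^ (i + j))" for i j
  have "((a \<otimes>\<^bsub>frob_skew_poly R p\<^esub> b) \<otimes>\<^bsub>frob_skew_poly R p\<^esub> c) n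
      = (\<Oplus>m\<in>{..n}. \<Oplus>i\<in>{..m}. f i (m - i))"
    unfolding skew_poly_simps
    by (intro finsum_cong') (auto simp: f_def finsum_ldistr Pi_def intro!: finsum_cong' finsum_closed)
  also have "\<dots> = (\<Oplus>i\<in>{..n}. \<Oplus>j\<in>{..n - i}. f i j)"
    by (rule finsum_triangle) (simp add: f_def)
  also have "\<dots> = (a \<otimes>\<^bsub>frob_skew_poly R p\<^esub> (b \<otimes>\<^bsub>frob_skew_poly R p\<^esub> c)) n"
    unfolding skew_poly_simps
    by (intro finsum_cong')
      (auto simp: f_def frob_pow_finsum finsum_rdistr Pi_def nat_pow_distrib nat_pow_pow m_assoc
        power_add mult.commute intro!: finsum_cong' finsum_closed)
  finally show "((a \<otimes>\<^bsub>frob_skew_poly R p\<^esub> b) \<otimes>\<^bsub>frob_skew_poly R p\<^esub> c) n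
      = (a \<otimes>\<^bsub>frob_skew_poly R p\<^esub> (b \<otimes>\<^bsub>frob_skew_poly R p\<^esub> c)) n" .
qed

lemma skew_mult_one:
  assumes a: "a \<in> up R"
  shows "\<one>\<^bsub>frob_skew_poly R p\<^esub> \<otimes>\<^bsub>frob_skew_poly R p\<^esub> a = a"
    and "a \<otimes>\<^bsub>frob_skew_poly R p\<^esub> \<one>\<^bsub>frob_skew_poly R p\<^esub> = a"
proof -
  have cl [simp]: "a i \<in> carrier R" for i
    using a by auto
  have "(\<Oplus>i\<in>{..n}. (if i = 0 then \<one> else \<zero>) \<otimes> a (n - i) [^] (p ^ i))
      = (\<Oplus>i\<in>{..n}. if 0 = i then a n else \<zero>)" for n
    by (intro finsum_cong') auto
  also have "\<dots> n = a n" for n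
    using finsum_singleton [of 0 "{..n}" "\<lambda>_. a n"] by simp
  finally show "\<one>\<^bsub>frob_skew_poly R p\<^esub> \<otimes>\<^bsub>frob_skew_poly R p\<^esub> a = a"
    by (simp add: fun_eq_iff skew_poly_simps)
  have "(\<Oplus>i\<in>{..n}. a i \<otimes> (if n - i = 0 then \<one> else \<zero>) [^] (p ^ i))
      = (\<Oplus>i\<in>{..n}. if n = i then a i else \<zero>)" for n
    by (intro finsum_cong') auto
  also have "\<dots> n = a n" for n
    using finsum_singleton [of n "{..n}" a] by (simp add: Pi_def)
  finally show "a \<otimes>\<^bsub>frob_skew_poly R p\<^esub> \<one>\<^bsub>frob_skew_poly R p\<^esub> = a"
    by (simp add: fun_eq_iff skew_poly_simps)
qed

text \<open>In a product whose right factor is a sum, the coefficients of that sum are raised to the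
  powers \<open>p ^ i\<close>; this distributive law rests on \<open>frob_pow_add\<close>.\<close>

lemma ring_frob_skew_poly: "ring (frob_skew_poly R p)"
proof (rule ringI)
  show "abelian_group (frob_skew_poly R p)"
  proof (rule abelian_groupI)
    fix a assume "a \<in> carrier (frob_skew_poly R p)"
    then have a: "a \<in> up R" by (simp add: skew_poly_simps)
    have "(\<lambda>i. \<ominus> a i) \<oplus>\<^bsub>frob_skew_poly R p\<^esub> a = \<zero>\<^bsub>frob_skew_poly R p\<^esub>"
      using a by (auto simp: skew_poly_simps fun_eq_iff l_neg mem_upD)
    then show "\<exists>b\<in>carrier (frob_skew_poly R p). b \<oplus>\<^bsub>frob_skew_poly R p\<^esub> a = \<zero>\<^bsub>frob_skew_poly R p\<^esub>"
      using up_a_inv_closed [OF a] by (auto simp: skew_poly_simps)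
  qed (auto simp: skew_poly_simps up_add_closed a_ac fun_eq_iff mem_upD)
  show "monoid (frob_skew_poly R p)"
    by (rule monoidI)
      (use skew_mult_closed skew_mult_assoc skew_mult_one up_one_closed in \<open>simp_all add: skew_poly_simps(1,3)\<close>)
qed (auto simp: skew_poly_simps fun_eq_iff l_distr r_distr frob_pow_add mem_upD Pi_def
    simp flip: finsum_addf intro!: finsum_cong')

end

section \<open>Modules over the skew polynomial ring\<close>

text \<open>The indeterminate acts as \<open>X\<close>. Summing over the support of
  \<open>a\<close>, which is finite for \<open>a \<in> up R\<close>, avoids choosing a degree
  bound.\<close>

definition skew_module ::
  "('a, 'r) ring_scheme \<Rightarrow> ('a, 'm) module \<Rightarrow> ('m \<Rightarrow> 'm) \<Rightarrow> (nat \<Rightarrow> 'a, 'm) module" where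
  "skew_module R M X = \<lparr>carrier = carrier M, monoid.mult = monoid.mult M, monoid.one = monoid.one M,
     ring.zero = ring.zero M, ring.add = ring.add M,
     smult = (\<lambda>a h. \<Oplus>\<^bsub>M\<^esub>i\<in>{i. a i \<noteq> \<zero>\<^bsub>R\<^esub>}. a i \<odot>\<^bsub>M\<^esub> (X ^^ i) h)\<rparr>"

lemma skew_module_simps [simp]:
  "carrier (skew_module R M X) = carrier M"
  "ring.zero (skew_module R M X) = ring.zero M"
  "ring.add (skew_module R M X) = ring.add M"
  by (simp_all add: skew_module_def)

text \<open>A Frobenius-semilinear endomorphism \<open>X\<close>: the rule \<open>X_smult\<close> is
  what x r = r^p x imposes on the action of x.\<close>

locale frobenius_action = F?: frobenius_ring R p + M?: module R M
  for R :: "('a, 'r) ring_scheme" (structure) and p and M :: "('a, 'm) module" (structure) +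
  fixes X :: "'m \<Rightarrow> 'm"
  assumes X_closed [simp]: "h \<in> carrier M \<Longrightarrow> X h \<in> carrier M"
    and X_add: "g \<in> carrier M \<Longrightarrow> h \<in> carrier M \<Longrightarrow> X (g \<oplus>\<^bsub>M\<^esub> h) = X g \<oplus>\<^bsub>M\<^esub> X h"
    and X_smult: "r \<in> carrier R \<Longrightarrow> h \<in> carrier M \<Longrightarrow> X (r \<odot>\<^bsub>M\<^esub> h) = (r [^] p) \<odot>\<^bsub>M\<^esub> X h"
begin

lemma X_pow_closed [simp]: "h \<in> carrier M \<Longrightarrow> (X ^^ i) h \<in> carrier M"
  by (induction i) auto

lemma X_pow_add:
  "g \<in> carrier M \<Longrightarrow> h \<in> carrier M \<Longrightarrow> (X ^^ i) (g \<oplus>\<^bsub>M\<^esub> h) = (X ^^ i) g \<oplus>\<^bsub>M\<^esub> (X ^^ i) h"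
  by (induction i) (auto simp: X_add)

lemma X_pow_smult:
  "r \<in> carrier R \<Longrightarrow> h \<in> carrier M \<Longrightarrow> (X ^^ i) (r \<odot>\<^bsub>M\<^esub> h) = (r [^] (p ^ i)) \<odot>\<^bsub>M\<^esub> (X ^^ i) h"
  by (induction i) (auto simp: X_smult nat_pow_pow mult.commute)

lemma X_pow_zero [simp]: "(X ^^ i) \<zero>\<^bsub>M\<^esub> = \<zero>\<^bsub>M\<^esub>"
  using X_pow_smult [of \<zero> "\<zero>\<^bsub>M\<^esub>" i] by simp

lemma X_pow_finsum:
  assumes "f \<in> A \<rightarrow> carrier M"
  shows "(X ^^ i) (\<Oplus>\<^bsub>M\<^esub>j\<in>A. f j) = (\<Oplus>\<^bsub>M\<^esub>j\<in>A. (X ^^ i) (f j))"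
  using assms by (induction A rule: infinite_finite_induct) (auto simp: X_pow_add Pi_def)

lemma finsum_smult_distr:
  assumes "f \<in> A \<rightarrow> carrier R" "h \<in> carrier M"
  shows "(\<Oplus>j\<in>A. f j) \<odot>\<^bsub>M\<^esub> h = (\<Oplus>\<^bsub>M\<^esub>j\<in>A. f j \<odot>\<^bsub>M\<^esub> h)"
  using assms by (induction A rule: infinite_finite_induct) (auto simp: smult_l_distr Pi_def)

text \<open>Replacing the support by an initial segment lets the actions of different skew
  polynomials be compared term by term over a common range.\<close>

lemma skew_smult_bound:
  assumes a: "a \<in> up R" and n: "bound \<zero> n a" and h: "h \<in> carrier M"
  shows "a \<odot>\<^bsub>skew_module R M X\<^esub> h = (\<Oplus>\<^bsub>M\<^esub>i\<in>{..n}. a i \<odot>\<^bsub>M\<^esub> (X ^^ i) h)"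
proof -
  have "{i. a i \<noteq> \<zero>} \<subseteq> {..n}"
    using bound_below [OF n] by auto
  then have "(\<Oplus>\<^bsub>M\<^esub>i\<in>{i. a i \<noteq> \<zero>}. a i \<odot>\<^bsub>M\<^esub> (X ^^ i) h) = (\<Oplus>\<^bsub>M\<^esub>i\<in>{..n}. a i \<odot>\<^bsub>M\<^esub> (X ^^ i) h)"
    using a h by (intro M.add.finprod_mono_neutral_cong_left) auto
  then show ?thesis by (simp add: skew_module_def)
qed

lemma skew_smult_monom:
  assumes "r \<in> carrier R" "h \<in> carrier M"
  shows "skew_monom R r n \<odot>\<^bsub>skew_module R M X\<^esub> h = r \<odot>\<^bsub>M\<^esub> (X ^^ n) h"
proof -
  have "skew_monom R r n \<in> up R" "bound \<zero> n (skew_monom R r n)"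
    using assms by (auto simp: skew_monom_def up_def)
  then have "skew_monom R r n \<odot>\<^bsub>skew_module R M X\<^esub> h
      = (\<Oplus>\<^bsub>M\<^esub>i\<in>{..n}. skew_monom R r n i \<odot>\<^bsub>M\<^esub> (X ^^ i) h)"
    using assms by (intro skew_smult_bound)
  also have "\<dots> = (\<Oplus>\<^bsub>M\<^esub>i\<in>{..n}. if n = i then r \<odot>\<^bsub>M\<^esub> (X ^^ i) h else \<zero>\<^bsub>M\<^esub>)"
    using assms by (intro M.finsum_cong') (auto simp: skew_monom_def)
  also have "\<dots> = r \<odot>\<^bsub>M\<^esub> (X ^^ n) h"
    using assms M.finsum_singleton [of n "{..n}" "\<lambda>i. r \<odot>\<^bsub>M\<^esub> (X ^^ i) h"] by (simp add: Pi_def)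
  finally show ?thesis .
qed

text \<open>By semilinearity of the powers of \<open>X\<close>, both sides become the sum of
  \<open>f i j\<close>, that is of a_i b_j^(p^i) X^(i+j) h, over the triangle i + j \<le> n.\<close>

lemma skew_smult_assoc:
  assumes a: "a \<in> up R" and b: "b \<in> up R" and h: "h \<in> carrier M"
  shows "(a \<otimes>\<^bsub>frob_skew_poly R p\<^esub> b) \<odot>\<^bsub>skew_module R M X\<^esub> h
    = a \<odot>\<^bsub>skew_module R M X\<^esub> (b \<odot>\<^bsub>skew_module R M X\<^esub> h)"
proof -
  obtain k l m where bounds: "bound \<zero> k a" "bound \<zero> l b"
      "bound \<zero> m (a \<otimes>\<^bsub>frob_skew_poly R p\<^esub> b)"
    using a b skew_mult_closed [OF a b] by blast
  \<comment> \<open>Large enough to bound the product and, for every i \<le> k, to leave the whole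
    support of \<open>b\<close> inside the shortened range \<open>{..n - i}\<close>. The premise
    \<open>i \<le> k\<close> attaches to all three facts below; \<open>na\<close> and
    \<open>nab\<close> are taken at i = 0.\<close>
  define n where "n = max m (k + l)"
  have na: "bound \<zero> n a" and nab: "bound \<zero> n (a \<otimes>\<^bsub>frob_skew_poly R p\<^esub> b)"
    and nb: "bound \<zero> (n - i) b" if "i \<le> k" for i
    using bounds that by (auto simp: n_def bound_def)
  have cl [simp]: "a i \<in> carrier R" "b i \<in> carrier R" for i
    using a b by auto
  have bh [simp]: "b \<odot>\<^bsub>skew_module R M X\<^esub> h \<in> carrier M"
    using h by (auto simp: skew_module_def intro!: M.finsum_closed)
  define f where "f i j = (a i \<otimes> b j [^] (p ^ i)) \<odot>\<^bsub>M\<^esub> (X ^^ (i + j)) h" for i j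
  have f: "f i j \<in> carrier M" for i j
    using h by (simp add: f_def)
  have "(a \<otimes>\<^bsub>frob_skew_poly R p\<^esub> b) \<odot>\<^bsub>skew_module R M X\<^esub> h
      = (\<Oplus>\<^bsub>M\<^esub>m\<in>{..n}. (a \<otimes>\<^bsub>frob_skew_poly R p\<^esub> b) m \<odot>\<^bsub>M\<^esub> (X ^^ m) h)"
    using nab [of 0] skew_mult_closed [OF a b] h by (simp add: skew_smult_bound)
  also have "\<dots> = (\<Oplus>\<^bsub>M\<^esub>m\<in>{..n}. \<Oplus>\<^bsub>M\<^esub>i\<in>{..m}. f i (m - i))"
    using h f
    by (intro M.finsum_cong') (auto simp: skew_poly_simps f_def finsum_smult_distr Pi_def
      intro!: M.finsum_closed M.finsum_cong')
  also have "\<dots> = (\<Oplus>\<^bsub>M\<^esub>i\<in>{..n}. \<Oplus>\<^bsub>M\<^esub>j\<in>{..n - i}. f i j)"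
    using f by (rule M.finsum_triangle)
  also have "\<dots> = (\<Oplus>\<^bsub>M\<^esub>i\<in>{..n}. a i \<odot>\<^bsub>M\<^esub> (X ^^ i) (b \<odot>\<^bsub>skew_module R M X\<^esub> h))"
  proof (intro M.finsum_cong')
    fix i
    show "(\<Oplus>\<^bsub>M\<^esub>j\<in>{..n - i}. f i j) = a i \<odot>\<^bsub>M\<^esub> (X ^^ i) (b \<odot>\<^bsub>skew_module R M X\<^esub> h)"
    proof (cases "i \<le> k")
      case True
      have "b \<odot>\<^bsub>skew_module R M X\<^esub> h = (\<Oplus>\<^bsub>M\<^esub>j\<in>{..n - i}. b j \<odot>\<^bsub>M\<^esub> (X ^^ j) h)"
        using nb [OF True] b h by (simp add: skew_smult_bound)
      then have "a i \<odot>\<^bsub>M\<^esub> (X ^^ i) (b \<odot>\<^bsub>skew_module R M X\<^esub> h)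
          = (\<Oplus>\<^bsub>M\<^esub>j\<in>{..n - i}. a i \<odot>\<^bsub>M\<^esub> (X ^^ i) (b j \<odot>\<^bsub>M\<^esub> (X ^^ j) h))"
        using h by (simp add: X_pow_finsum finsum_smult_ldistr Pi_def)
      also have "\<dots> = (\<Oplus>\<^bsub>M\<^esub>j\<in>{..n - i}. f i j)"
        using h by (intro M.finsum_cong') (auto simp: f_def X_pow_smult smult_assoc1 funpow_add)
      finally show ?thesis by simp
    next
      case False
      then have "a i = \<zero>" using bounds(1) by (simp add: bound_def)
      then show ?thesis using h by (simp add: f_def)
    qed
  qed simp_all
  also have "\<dots> = a \<odot>\<^bsub>skew_module R M X\<^esub> (b \<odot>\<^bsub>skew_module R M X\<^esub> h)"
    using na [of 0] a by (simp add: skew_smult_bound)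
  finally show ?thesis .
qed

lemma left_module_skew_module: "left_module (frob_skew_poly R p) (skew_module R M X)"
proof -
  have ag: "abelian_group (skew_module R M X)"
    by (rule abelian_groupI)
      (auto simp: M.a_ac intro: M.l_neg M.a_inv_closed)
  have closed: "a \<odot>\<^bsub>skew_module R M X\<^esub> h \<in> carrier M" if "a \<in> up R" "h \<in> carrier M" for a h
    using that by (auto simp: skew_module_def intro!: M.finsum_closed)
  have ldistr: "(a \<oplus>\<^bsub>frob_skew_poly R p\<^esub> b) \<odot>\<^bsub>skew_module R M X\<^esub> h
      = a \<odot>\<^bsub>skew_module R M X\<^esub> h \<oplus>\<^bsub>M\<^esub> b \<odot>\<^bsub>skew_module R M X\<^esub> h"
    if a: "a \<in> up R" and b: "b \<in> up R" and h: "h \<in> carrier M" for a b h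
  proof -
    obtain k l where "bound \<zero> k a" "bound \<zero> l b"
      using a b by blast
    then have n: "bound \<zero> (max k l) a" "bound \<zero> (max k l) b" "bound \<zero> (max k l) (\<lambda>i. a i \<oplus> b i)"
      by (auto simp: bound_def)
    have cl [simp]: "a i \<in> carrier R" "b i \<in> carrier R" for i
      using a b by auto
    show ?thesis
      using n a b h up_add_closed [OF a b]
      by (simp add: skew_poly_simps skew_smult_bound smult_l_distr Pi_def flip: M.finsum_addf)
  qed
  have rdistr: "a \<odot>\<^bsub>skew_module R M X\<^esub> (g \<oplus>\<^bsub>M\<^esub> h)
      = a \<odot>\<^bsub>skew_module R M X\<^esub> g \<oplus>\<^bsub>M\<^esub> a \<odot>\<^bsub>skew_module R M X\<^esub> h"
    if a: "a \<in> up R" and g: "g \<in> carrier M" and h: "h \<in> carrier M" for a g h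
  proof -
    obtain n where n: "bound \<zero> n a"
      using a by blast
    have cl [simp]: "a i \<in> carrier R" for i
      using a by auto
    show ?thesis
      using n a g h
      by (simp add: skew_smult_bound X_pow_add smult_r_distr Pi_def flip: M.finsum_addf)
  qed
  have "\<one>\<^bsub>frob_skew_poly R p\<^esub> = skew_monom R \<one> 0"
    by (simp add: skew_poly_simps skew_monom_def)
  then have one: "\<one>\<^bsub>frob_skew_poly R p\<^esub> \<odot>\<^bsub>skew_module R M X\<^esub> h = h" if "h \<in> carrier M" for h
    using that by (simp add: skew_smult_monom)
  show ?thesis
    using closed ldistr rdistr skew_smult_assoc one
    by (intro left_module.intro left_module_axioms.intro ring_frob_skew_poly ag)
      (simp_all add: skew_poly_simps(1))
qed

lemma extends_to_skew_module_skew_module: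
  "extends_to_skew_module R p M (skew_module R M X)"
proof -
  have "skew_monom R r 0 \<odot>\<^bsub>skew_module R M X\<^esub> h = r \<odot>\<^bsub>M\<^esub> h"
    if "r \<in> carrier R" "h \<in> carrier M" for r h
    using that by (simp add: skew_smult_monom)
  then show ?thesis
    using left_module_skew_module
    by (simp add: extends_to_skew_module_def)
qed

text \<open>The n-th power of x acts as \<open>X ^^ n\<close>, and iterates of a map with trivial
  kernel again have trivial kernel.\<close>

lemma x_torsion_free_skew_module:
  assumes inj: "\<And>h. h \<in> carrier M \<Longrightarrow> X h = \<zero>\<^bsub>M\<^esub> \<Longrightarrow> h = \<zero>\<^bsub>M\<^esub>"
  shows "x_torsion_free R p (skew_module R M X)"
proof -
  interpret S: ring "frob_skew_poly R p"
    by (rule ring_frob_skew_poly)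
  have xpow: "skew_X R [^]\<^bsub>frob_skew_poly R p\<^esub> n = skew_monom R \<one> n" for n :: nat
  proof (induction n)
    case 0
    show ?case by (simp add: skew_poly_simps skew_monom_def)
  next
    case (Suc n)
    then show ?case
      using skew_monom_mult [of \<one> \<one> p n 1] by simp
  qed
  have "(X ^^ n) h = \<zero>\<^bsub>M\<^esub> \<Longrightarrow> h = \<zero>\<^bsub>M\<^esub>" if "h \<in> carrier M" for n h
    using that by (induction n) (auto dest!: inj [OF X_pow_closed])
  \<comment> \<open>Zero belongs to the torsion set with exponent 1, the least exponent allowed
    there.\<close>
  moreover have "(X ^^ 1) \<zero>\<^bsub>M\<^esub> = \<zero>\<^bsub>M\<^esub>"
    by (rule X_pow_zero)
  ultimately have "{h \<in> carrier M. \<exists>n\<ge>1. (X ^^ n) h = \<zero>\<^bsub>M\<^esub>} = {\<zero>\<^bsub>M\<^esub>}"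
    by blast
  then show ?thesis
    unfolding x_torsion_free_def x_torsion_def xpow
    by (simp add: skew_smult_monom cong: conj_cong)
qed

end

section \<open>Baer's criterion\<close>

lemma (in abelian_group) minus_eq_zeroD:
  assumes "x \<in> carrier G" "y \<in> carrier G" "x \<ominus> y = \<zero>"
  shows "x = y"
  using assms minus_equality [of x "\<ominus> y"] by (simp add: a_minus_def)

section \<open>Module homomorphisms and copies of modules in other types\<close>

lemma module_homI:
  assumes "\<And>x. x \<in> carrier M \<Longrightarrow> \<phi> x \<in> carrier N"
    and "\<And>x y. x \<in> carrier M \<Longrightarrow> y \<in> carrier M \<Longrightarrow> \<phi> (x \<oplus>\<^bsub>M\<^esub> y) = \<phi> x \<oplus>\<^bsub>N\<^esub> \<phi> y"
    and "\<And>r x. r \<in> carrier R \<Longrightarrow> x \<in> carrier M \<Longrightarrow> \<phi> (r \<odot>\<^bsub>M\<^esub> x) = r \<odot>\<^bsub>N\<^esub> \<phi> x"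
  shows "\<phi> \<in> module_hom R M N"
  using assms by (simp add: module_hom_def)

lemma module_homD:
  assumes "\<phi> \<in> module_hom R M N"
  shows "x \<in> carrier M \<Longrightarrow> \<phi> x \<in> carrier N"
    and "x \<in> carrier M \<Longrightarrow> y \<in> carrier M \<Longrightarrow> \<phi> (x \<oplus>\<^bsub>M\<^esub> y) = \<phi> x \<oplus>\<^bsub>N\<^esub> \<phi> y"
    and "r \<in> carrier R \<Longrightarrow> x \<in> carrier M \<Longrightarrow> \<phi> (r \<odot>\<^bsub>M\<^esub> x) = r \<odot>\<^bsub>N\<^esub> \<phi> x"
  using assms by (auto simp: module_hom_def)

lemma module_hom_comp:
  assumes "\<phi> \<in> module_hom R L M" and "\<psi> \<in> module_hom R M N"
  shows "(\<lambda>x. \<psi> (\<phi> x)) \<in> module_hom R L N"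
  using assms by (simp add: module_hom_def Pi_def)

lemma module_hom_zero:
  assumes "module R M" "module R N" "\<phi> \<in> module_hom R M N"
  shows "\<phi> \<zero>\<^bsub>M\<^esub> = \<zero>\<^bsub>N\<^esub>"
proof -
  interpret M: module R M by fact
  interpret N: module R N by fact
  show ?thesis
    using module_homD(3) [OF assms(3), of "\<zero>\<^bsub>R\<^esub>" "\<zero>\<^bsub>M\<^esub>"] module_homD(1) [OF assms(3), of "\<zero>\<^bsub>M\<^esub>"]
    by simp
qed

text \<open>For \<open>f\<close> injective on the carrier, this is an isomorphic copy of
  \<open>M\<close> inside the type \<open>'u\<close>. It moves ideals and \<open>E\<close> into the
  universe over which injectivity and F-purity quantify.\<close>

definition transport_module :: "('a, 'm) module \<Rightarrow> ('m \<Rightarrow> 'u) \<Rightarrow> ('a, 'u) module" where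
  "transport_module M f = (let g = inv_into (carrier M) f in
     \<lparr>carrier = f ` carrier M, monoid.mult = undefined, monoid.one = undefined,
      ring.zero = f \<zero>\<^bsub>M\<^esub>, ring.add = (\<lambda>x y. f (g x \<oplus>\<^bsub>M\<^esub> g y)), smult = (\<lambda>r x. f (r \<odot>\<^bsub>M\<^esub> g x))\<rparr>)"

lemma
  assumes "module R M" and inj: "inj_on f (carrier M)"
  shows module_transport: "module R (transport_module M f)"
    and transport_hom: "f \<in> module_hom R M (transport_module M f)"
    and transport_inv_hom: "inv_into (carrier M) f \<in> module_hom R (transport_module M f) M"
proof -
  interpret M: module R M by fact
  have T [simp]: "carrier (transport_module M f) = f ` carrier M"
      "\<zero>\<^bsub>transport_module M f\<^esub> = f \<zero>\<^bsub>M\<^esub>"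
    by (simp_all add: transport_module_def Let_def)
  have add [simp]: "f x \<oplus>\<^bsub>transport_module M f\<^esub> f y = f (x \<oplus>\<^bsub>M\<^esub> y)"
    if "x \<in> carrier M" "y \<in> carrier M" for x y
    using that inj by (simp add: transport_module_def Let_def)
  have smult [simp]: "r \<odot>\<^bsub>transport_module M f\<^esub> f x = f (r \<odot>\<^bsub>M\<^esub> x)" if "x \<in> carrier M" for r x
    using that inj by (simp add: transport_module_def Let_def)
  have "\<exists>y\<in>carrier M. f (y \<oplus>\<^bsub>M\<^esub> x) = f \<zero>\<^bsub>M\<^esub>" if "x \<in> carrier M" for x
    using that M.M.l_neg M.M.a_inv_closed by metis
  then have "abelian_group (transport_module M f)"
    by (intro abelian_groupI) (auto simp: M.M.a_ac)
  then show "module R (transport_module M f)"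
    by (intro moduleI M.R.is_cring)
      (auto simp: M.smult_l_distr M.smult_r_distr M.smult_assoc1)
  show "f \<in> module_hom R M (transport_module M f)"
    by (rule module_homI) auto
  show "inv_into (carrier M) f \<in> module_hom R (transport_module M f) M"
    using inj by (intro module_homI) auto
qed

text \<open>Taken at \<open>I = carrier R\<close>, this is also the ring as a module over
  itself.\<close>

definition ideal_module :: "('a, 'r) ring_scheme \<Rightarrow> 'a set \<Rightarrow> ('a, 'a) module" where
  "ideal_module R I = \<lparr>carrier = I, monoid.mult = monoid.mult R, monoid.one = \<one>\<^bsub>R\<^esub>,
     ring.zero = \<zero>\<^bsub>R\<^esub>, ring.add = ring.add R, smult = monoid.mult R\<rparr>"

lemma ideal_module_simps [simp]:
  "carrier (ideal_module R I) = I"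
  "\<zero>\<^bsub>ideal_module R I\<^esub> = \<zero>\<^bsub>R\<^esub>"
  "x \<oplus>\<^bsub>ideal_module R I\<^esub> y = x \<oplus>\<^bsub>R\<^esub> y"
  "x \<odot>\<^bsub>ideal_module R I\<^esub> y = x \<otimes>\<^bsub>R\<^esub> y"
  by (simp_all add: ideal_module_def)

lemma (in cring) module_ideal_module:
  assumes "ideal I R"
  shows "module R (ideal_module R I)"
proof -
  interpret I: ideal I R by fact
  have [simp]: "x \<in> carrier R" if "x \<in> I" for x
    using that by (rule I.Icarr)
  have "\<exists>y\<in>I. y \<oplus> x = \<zero>" if "x \<in> I" for x
    using that l_neg I.a_inv_closed by (intro bexI [of _ "\<ominus> x"]) auto
  then have "abelian_group (ideal_module R I)"
    by (intro abelian_groupI) (auto simp: a_ac I.a_closed I.zero_closed)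
  then show ?thesis
    by (intro moduleI is_cring) (auto simp: l_distr r_distr m_assoc I.I_l_closed)
qed

text \<open>The injection \<open>f\<close> places copies of \<open>I\<close> and \<open>R\<close> in
  the universe. Extending \<open>h\<close> along the inclusion of \<open>I\<close> in
  \<open>R\<close> gives a map on all of \<open>R\<close>, and \<open>e\<close> is its value at
  1.\<close>

lemma injective_module_imp_baer:
  fixes R :: "('a, 'r) ring_scheme" and E :: "('a, 'e) module" and f :: "'a \<Rightarrow> 'u"
  assumes E: "injective_module TYPE('u) R E" and inj: "inj_on f (carrier R)"
    and I: "ideal I R" and h: "h \<in> module_hom R (ideal_module R I) E"
  shows "\<exists>e\<in>carrier E. \<forall>r\<in>I. h r = r \<odot>\<^bsub>E\<^esub> e"
proof -
  interpret E: module R E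
    using E by (simp add: injective_module_def)
  have sub: "I \<subseteq> carrier R"
    using I by (meson additive_subgroup.a_subset ideal.axioms(1))
  have injI: "inj_on f I"
    using inj sub by (rule inj_on_subset)
  define A where "A = transport_module (ideal_module R I) f"
  define B where "B = transport_module (ideal_module R (carrier R)) f"
  have mI: "module R (ideal_module R I)" "module R (ideal_module R (carrier R))"
    using I E.R.oneideal by (auto intro: E.R.module_ideal_module)
  have A: "module R A" "inv_into I f \<in> module_hom R A (ideal_module R I)"
    using module_transport [OF mI(1)] transport_inv_hom [OF mI(1)] injI by (simp_all add: A_def)
  have B: "module R B" "f \<in> module_hom R (ideal_module R (carrier R)) B"
    using module_transport [OF mI(2)] transport_hom [OF mI(2)] inj by (simp_all add: B_def)
  have incl: "(\<lambda>x. x) \<in> module_hom R (ideal_module R I) (ideal_module R (carrier R))"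
    using sub by (intro module_homI) auto
  \<comment> \<open>The inclusion of \<open>I\<close> in \<open>R\<close>, read through the two
    copies.\<close>
  define j where "j = (\<lambda>x. f (inv_into I f x))"
  have cA: "carrier A = f ` I"
    by (simp add: A_def transport_module_def Let_def)
  have j: "j \<in> module_hom R A B" "inj_on j (carrier A)"
    unfolding j_def using module_hom_comp [OF module_hom_comp [OF A(2) incl] B(2)]
    by (auto simp: cA injI intro!: inj_onI)
  have "(\<lambda>x. h (inv_into I f x)) \<in> module_hom R A E"
    using A(2) h by (rule module_hom_comp)
  then obtain \<psi> where \<psi>: "\<psi> \<in> module_hom R B E" "\<And>a. a \<in> carrier A \<Longrightarrow> \<psi> (j a) = h (inv_into I f a)"
    using E A(1) B(1) j unfolding injective_module_def by meson
  have \<psi>f: "(\<lambda>x. \<psi> (f x)) \<in> module_hom R (ideal_module R (carrier R)) E"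
    using B(2) \<psi>(1) by (rule module_hom_comp)
  show ?thesis
  proof (intro bexI ballI)
    fix r assume r: "r \<in> I"
    then have "h r = \<psi> (f r)"
      using \<psi>(2) [of "f r"] injI by (simp add: cA j_def)
    also have "\<dots> = r \<odot>\<^bsub>E\<^esub> \<psi> (f \<one>\<^bsub>R\<^esub>)"
      using module_homD(3) [OF \<psi>f, of r "\<one>\<^bsub>R\<^esub>"] r sub by auto
    finally show "h r = r \<odot>\<^bsub>E\<^esub> \<psi> (f \<one>\<^bsub>R\<^esub>)" .
  next
    show "\<psi> (f \<one>\<^bsub>R\<^esub>) \<in> carrier E"
      using module_homD(1) [OF \<psi>f] by simp
  qed
qed

text \<open>Partial homomorphisms, as graphs, so that Zorn's lemma applies to inclusion.\<close>

definition hom_graph ::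
  "('a, 'r) ring_scheme \<Rightarrow> ('a, 'b) module \<Rightarrow> ('a, 'e) module \<Rightarrow> ('b \<times> 'e) set \<Rightarrow> bool" where
  "hom_graph R B E G \<longleftrightarrow> G \<subseteq> carrier B \<times> carrier E \<and> (\<zero>\<^bsub>B\<^esub>, \<zero>\<^bsub>E\<^esub>) \<in> G \<and>
     (\<forall>a y b z. (a, y) \<in> G \<and> (b, z) \<in> G \<longrightarrow> (a \<oplus>\<^bsub>B\<^esub> b, y \<oplus>\<^bsub>E\<^esub> z) \<in> G) \<and>
     (\<forall>r\<in>carrier R. \<forall>a y. (a, y) \<in> G \<longrightarrow> (r \<odot>\<^bsub>B\<^esub> a, r \<odot>\<^bsub>E\<^esub> y) \<in> G) \<and>
     (\<forall>y. (\<zero>\<^bsub>B\<^esub>, y) \<in> G \<longrightarrow> y = \<zero>\<^bsub>E\<^esub>)"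

lemma hom_graphD:
  assumes "hom_graph R B E G"
  shows "(a, y) \<in> G \<Longrightarrow> a \<in> carrier B" "(a, y) \<in> G \<Longrightarrow> y \<in> carrier E"
    "(\<zero>\<^bsub>B\<^esub>, \<zero>\<^bsub>E\<^esub>) \<in> G"
    "(a, y) \<in> G \<Longrightarrow> (b, z) \<in> G \<Longrightarrow> (a \<oplus>\<^bsub>B\<^esub> b, y \<oplus>\<^bsub>E\<^esub> z) \<in> G"
    "r \<in> carrier R \<Longrightarrow> (a, y) \<in> G \<Longrightarrow> (r \<odot>\<^bsub>B\<^esub> a, r \<odot>\<^bsub>E\<^esub> y) \<in> G"
    "(\<zero>\<^bsub>B\<^esub>, y) \<in> G \<Longrightarrow> y = \<zero>\<^bsub>E\<^esub>"
  using assms unfolding hom_graph_def by blast+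

text \<open>Any two pairs of the union lie in a common member of the chain, so every closure
  condition can be checked inside a single graph.\<close>

lemma hom_graph_Union_chain:
  assumes ne: "\<C> \<noteq> {}" and chain: "subset.chain {G. hom_graph R B E G} \<C>"
  shows "hom_graph R B E (\<Union>\<C>)"
proof -
  have G: "hom_graph R B E G" if "G \<in> \<C>" for G
    using chain that by (auto simp: subset_chain_def)
  have common: "\<exists>G\<in>\<C>. x \<in> G \<and> y \<in> G" if "x \<in> \<Union>\<C>" "y \<in> \<Union>\<C>" for x y
    using that chain unfolding subset_chain_def by (meson UnionE subsetD)
  have "(a \<oplus>\<^bsub>B\<^esub> b, y \<oplus>\<^bsub>E\<^esub> z) \<in> \<Union>\<C>" if "(a, y) \<in> \<Union>\<C>" "(b, z) \<in> \<Union>\<C>" for a y b z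
    using common [OF that] hom_graphD(4) [OF G] by blast
  then show ?thesis
    unfolding hom_graph_def
  proof (intro conjI allI impI ballI)
    show "\<Union>\<C> \<subseteq> carrier B \<times> carrier E"
      using hom_graphD(1,2) [OF G] by auto
    show "(\<zero>\<^bsub>B\<^esub>, \<zero>\<^bsub>E\<^esub>) \<in> \<Union>\<C>"
      using ne hom_graphD(3) [OF G] by blast
    show "(r \<odot>\<^bsub>B\<^esub> a, r \<odot>\<^bsub>E\<^esub> y) \<in> \<Union>\<C>" if "r \<in> carrier R" "(a, y) \<in> \<Union>\<C>" for r a y
      using that hom_graphD(5) [OF G] by blast
    show "y = \<zero>\<^bsub>E\<^esub>" if "(\<zero>\<^bsub>B\<^esub>, y) \<in> \<Union>\<C>" for y
      using that hom_graphD(6) [OF G] by blast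
  qed blast
qed

text \<open>Adding the (-1)-multiple of one pair to the other yields a pair over zero, whose second
  component must vanish.\<close>

lemma hom_graph_single_valued:
  assumes "module R B" "module R E" and G: "hom_graph R B E G" and "(a, y) \<in> G" "(a, z) \<in> G"
  shows "y = z"
proof -
  interpret B: module R B by fact
  interpret E: module R E by fact
  note G' = hom_graphD [OF G]
  have cl: "a \<in> carrier B" "y \<in> carrier E" "z \<in> carrier E"
    using assms(4,5) G'(1,2) by blast+
  have "((\<ominus>\<^bsub>R\<^esub> \<one>\<^bsub>R\<^esub>) \<odot>\<^bsub>B\<^esub> a, (\<ominus>\<^bsub>R\<^esub> \<one>\<^bsub>R\<^esub>) \<odot>\<^bsub>E\<^esub> z) \<in> G"
    using assms(5) by (intro G'(5)) auto
  then have "(\<zero>\<^bsub>B\<^esub>, y \<ominus>\<^bsub>E\<^esub> z) \<in> G"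
    using G'(4) [OF assms(4)] cl
    by (fastforce simp: B.smult_l_minus E.smult_l_minus B.M.r_neg a_minus_def)
  then show ?thesis
    using G'(6) cl E.M.minus_eq_zeroD by blast
qed

text \<open>The new graph is G + R(b, e). The hypothesis \<open>compat\<close> says that
  \<open>e\<close> agrees with \<open>G\<close> on every multiple of \<open>b\<close> already in its
  domain, which keeps the enlarged relation single-valued.\<close>

lemma hom_graph_adjoin:
  assumes "module R B" "module R E" and G: "hom_graph R B E G"
    and b: "b \<in> carrier B" and e: "e \<in> carrier E"
    and compat: "\<And>r y. r \<in> carrier R \<Longrightarrow> (r \<odot>\<^bsub>B\<^esub> b, y) \<in> G \<Longrightarrow> y = r \<odot>\<^bsub>E\<^esub> e"
  shows "\<exists>G'. hom_graph R B E G' \<and> G \<subseteq> G' \<and> (b, e) \<in> G'"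
proof -
  interpret B: module R B by fact
  interpret E: module R E by fact
  note G' = hom_graphD [OF G]
  let ?G = "{(a \<oplus>\<^bsub>B\<^esub> r \<odot>\<^bsub>B\<^esub> b, y \<oplus>\<^bsub>E\<^esub> r \<odot>\<^bsub>E\<^esub> e) | a y r. (a, y) \<in> G \<and> r \<in> carrier R}"
  have mem: "(a \<oplus>\<^bsub>B\<^esub> r \<odot>\<^bsub>B\<^esub> b, y \<oplus>\<^bsub>E\<^esub> r \<odot>\<^bsub>E\<^esub> e) \<in> ?G" if "(a, y) \<in> G" "r \<in> carrier R" for a y r
    using that by blast
  have elim: thesis if "(c, w) \<in> ?G"
    "\<And>a y r. (a, y) \<in> G \<Longrightarrow> a \<in> carrier B \<Longrightarrow> y \<in> carrier E \<Longrightarrow> r \<in> carrier R \<Longrightarrow>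
       c = a \<oplus>\<^bsub>B\<^esub> r \<odot>\<^bsub>B\<^esub> b \<Longrightarrow> w = y \<oplus>\<^bsub>E\<^esub> r \<odot>\<^bsub>E\<^esub> e \<Longrightarrow> thesis" for c w thesis
    using that G'(1,2) by blast
  have sub: "G \<subseteq> ?G"
  proof
    fix x assume "x \<in> G"
    then show "x \<in> ?G"
      using mem [of "fst x" "snd x" "\<zero>\<^bsub>R\<^esub>"] G'(1,2) [of "fst x" "snd x"] b e by simp
  qed
  have "hom_graph R B E ?G"
    unfolding hom_graph_def
  proof (intro conjI allI impI ballI)
    show "?G \<subseteq> carrier B \<times> carrier E"
      using G'(1,2) b e by auto
    show "(\<zero>\<^bsub>B\<^esub>, \<zero>\<^bsub>E\<^esub>) \<in> ?G"
      using sub G'(3) by blast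
    show "(c \<oplus>\<^bsub>B\<^esub> d, w \<oplus>\<^bsub>E\<^esub> v) \<in> ?G" if "(c, w) \<in> ?G \<and> (d, v) \<in> ?G" for c w d v
    proof -
      from that have c: "(c, w) \<in> ?G" and d: "(d, v) \<in> ?G" by blast+
      show ?thesis
      proof (rule elim [OF c], rule elim [OF d])
        fix a y r a' y' r'
        assume *: "(a, y) \<in> G" "a \<in> carrier B" "y \<in> carrier E" "r \<in> carrier R"
          "(a', y') \<in> G" "a' \<in> carrier B" "y' \<in> carrier E" "r' \<in> carrier R"
          "c = a \<oplus>\<^bsub>B\<^esub> r \<odot>\<^bsub>B\<^esub> b" "w = y \<oplus>\<^bsub>E\<^esub> r \<odot>\<^bsub>E\<^esub> e"
          "d = a' \<oplus>\<^bsub>B\<^esub> r' \<odot>\<^bsub>B\<^esub> b" "v = y' \<oplus>\<^bsub>E\<^esub> r' \<odot>\<^bsub>E\<^esub> e"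
        then have "c \<oplus>\<^bsub>B\<^esub> d = (a \<oplus>\<^bsub>B\<^esub> a') \<oplus>\<^bsub>B\<^esub> (r \<oplus>\<^bsub>R\<^esub> r') \<odot>\<^bsub>B\<^esub> b"
            "w \<oplus>\<^bsub>E\<^esub> v = (y \<oplus>\<^bsub>E\<^esub> y') \<oplus>\<^bsub>E\<^esub> (r \<oplus>\<^bsub>R\<^esub> r') \<odot>\<^bsub>E\<^esub> e"
          using b e by (simp_all add: B.smult_l_distr E.smult_l_distr B.M.a_ac E.M.a_ac)
        then show ?thesis
          using mem [OF G'(4) [OF *(1,5)], of "r \<oplus>\<^bsub>R\<^esub> r'"] *(4,8) by simp
      qed
    qed
    show "(s \<odot>\<^bsub>B\<^esub> c, s \<odot>\<^bsub>E\<^esub> w) \<in> ?G" if s: "s \<in> carrier R" and c: "(c, w) \<in> ?G" for s c w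
    proof (rule elim [OF c])
      fix a y r
      assume *: "(a, y) \<in> G" "a \<in> carrier B" "y \<in> carrier E" "r \<in> carrier R"
        "c = a \<oplus>\<^bsub>B\<^esub> r \<odot>\<^bsub>B\<^esub> b" "w = y \<oplus>\<^bsub>E\<^esub> r \<odot>\<^bsub>E\<^esub> e"
      then have "s \<odot>\<^bsub>B\<^esub> c = s \<odot>\<^bsub>B\<^esub> a \<oplus>\<^bsub>B\<^esub> (s \<otimes>\<^bsub>R\<^esub> r) \<odot>\<^bsub>B\<^esub> b"
          "s \<odot>\<^bsub>E\<^esub> w = s \<odot>\<^bsub>E\<^esub> y \<oplus>\<^bsub>E\<^esub> (s \<otimes>\<^bsub>R\<^esub> r) \<odot>\<^bsub>E\<^esub> e"
        using s b e
        by (simp_all add: B.smult_r_distr E.smult_r_distr B.smult_assoc1 E.smult_assoc1)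
      then show ?thesis
        using mem [OF G'(5) [OF s *(1)], of "s \<otimes>\<^bsub>R\<^esub> r"] s *(4) by simp
    qed
    show "w = \<zero>\<^bsub>E\<^esub>" if c: "(\<zero>\<^bsub>B\<^esub>, w) \<in> ?G" for w
    proof (rule elim [OF c])
      fix a y r
      assume *: "(a, y) \<in> G" "a \<in> carrier B" "y \<in> carrier E" "r \<in> carrier R"
        "\<zero>\<^bsub>B\<^esub> = a \<oplus>\<^bsub>B\<^esub> r \<odot>\<^bsub>B\<^esub> b" "w = y \<oplus>\<^bsub>E\<^esub> r \<odot>\<^bsub>E\<^esub> e"
      \<comment> \<open>Now \<open>a\<close> is a multiple of \<open>b\<close> in the domain of
        \<open>G\<close>, so \<open>compat\<close> determines \<open>y\<close> and the two parts of
        \<open>w\<close> cancel.\<close>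
      then have "a = (\<ominus>\<^bsub>R\<^esub> r) \<odot>\<^bsub>B\<^esub> b"
        using b by (metis B.M.minus_equality B.smult_closed B.smult_l_minus)
      then have "y = (\<ominus>\<^bsub>R\<^esub> r) \<odot>\<^bsub>E\<^esub> e"
        using * compat by auto
      then show ?thesis
        using * e by (simp add: E.smult_l_minus E.M.l_neg)
    qed
  qed
  moreover have "(b, e) \<in> ?G"
    using mem [OF G'(3), of "\<one>\<^bsub>R\<^esub>"] b e by simp
  ultimately show ?thesis
    using sub by blast
qed

text \<open>A maximal graph above \<open>G0\<close> is defined everywhere: otherwise the extension
  property for ideals would allow one more element to be adjoined. The type of \<open>B\<close> is
  unconstrained, so the universe in which \<open>E\<close> was assumed injective no longer
  matters.\<close>

theorem baer_extension:
  fixes R :: "('a, 'r) ring_scheme" and B :: "('a, 'b) module" and E :: "('a, 'e) module"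
  assumes B: "module R B" and E: "module R E"
    and baer: "\<And>I h. ideal I R \<Longrightarrow> h \<in> module_hom R (ideal_module R I) E \<Longrightarrow>
      \<exists>e\<in>carrier E. \<forall>r\<in>I. h r = r \<odot>\<^bsub>E\<^esub> e"
    and G0: "hom_graph R B E G0"
  shows "\<exists>\<psi>\<in>module_hom R B E. \<forall>(a, y)\<in>G0. \<psi> a = y"
proof -
  interpret B: module R B by fact
  interpret E: module R E by fact
  let ?\<A> = "{G. hom_graph R B E G \<and> G0 \<subseteq> G}"
  have "\<exists>G\<in>?\<A>. \<forall>X\<in>?\<A>. G \<subseteq> X \<longrightarrow> X = G"
  proof (rule subset_Zorn_nonempty)
    show "?\<A> \<noteq> {}" using G0 by blast
    show "\<Union>\<C> \<in> ?\<A>" if ne: "\<C> \<noteq> {}" and chain: "subset.chain ?\<A> \<C>" for \<C>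
    proof -
      have "subset.chain {G. hom_graph R B E G} \<C>"
        using chain by (auto simp: subset_chain_def)
      moreover have "G0 \<subseteq> \<Union>\<C>"
        using ne chain by (force simp: subset_chain_def)
      ultimately show ?thesis
        using hom_graph_Union_chain [OF ne] by blast
    qed
  qed
  then obtain G where G: "hom_graph R B E G" "G0 \<subseteq> G"
    and max: "\<forall>X\<in>?\<A>. G \<subseteq> X \<longrightarrow> X = G"
    by (elim bexE) blast
  note G' = hom_graphD [OF G(1)]
  note unique = hom_graph_single_valued [OF B E G(1)]
  have total: "\<exists>y. (b, y) \<in> G" if b: "b \<in> carrier B" for b
  proof -
    define I where "I = {r \<in> carrier R. \<exists>y. (r \<odot>\<^bsub>B\<^esub> b, y) \<in> G}"
    define h where "h r = (THE y. (r \<odot>\<^bsub>B\<^esub> b, y) \<in> G)" for r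
    have h_eq: "h r = y" if "(r \<odot>\<^bsub>B\<^esub> b, y) \<in> G" for r y
      using that unique by (auto simp: h_def)
    have hI: "(r \<odot>\<^bsub>B\<^esub> b, h r) \<in> G" "r \<in> carrier R" if "r \<in> I" for r
      using that h_eq by (auto simp: I_def)
    have add: "((r \<oplus>\<^bsub>R\<^esub> s) \<odot>\<^bsub>B\<^esub> b, h r \<oplus>\<^bsub>E\<^esub> h s) \<in> G" if "r \<in> I" "s \<in> I" for r s
      using G'(4) [OF hI(1) [OF that(1)] hI(1) [OF that(2)]] hI(2) that b
      by (simp add: B.smult_l_distr)
    have mul: "((s \<otimes>\<^bsub>R\<^esub> r) \<odot>\<^bsub>B\<^esub> b, s \<odot>\<^bsub>E\<^esub> h r) \<in> G" if "r \<in> I" "s \<in> carrier R" for r s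
      using G'(5) [OF that(2) hI(1) [OF that(1)]] hI(2) that b
      by (simp add: B.smult_assoc1)
    have memI: "r \<in> I" if "r \<in> carrier R" "(r \<odot>\<^bsub>B\<^esub> b, y) \<in> G" for r y
      using that by (auto simp: I_def)
    have l_closed: "s \<otimes>\<^bsub>R\<^esub> r \<in> I" if "r \<in> I" "s \<in> carrier R" for r s
      using memI [OF _ mul [OF that]] hI(2) that by simp
    have "ideal I R"
    proof (rule idealI [OF B.R.ring_axioms])
      show "subgroup I (add_monoid R)"
      proof (rule B.R.add.subgroupI)
        show "I \<subseteq> carrier R" by (auto simp: I_def)
        show "I \<noteq> {}"
          using memI [of "\<zero>\<^bsub>R\<^esub>" "\<zero>\<^bsub>E\<^esub>"] G'(3) b by auto
        show "\<ominus>\<^bsub>R\<^esub> r \<in> I" if "r \<in> I" for r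
          using l_closed [OF that, of "\<ominus>\<^bsub>R\<^esub> \<one>\<^bsub>R\<^esub>"] hI(2) [OF that] by (simp add: B.R.l_minus)
        show "r \<oplus>\<^bsub>R\<^esub> s \<in> I" if "r \<in> I" "s \<in> I" for r s
          using memI [OF _ add [OF that]] hI(2) that by simp
      qed
      show "s \<otimes>\<^bsub>R\<^esub> r \<in> I" "r \<otimes>\<^bsub>R\<^esub> s \<in> I" if "r \<in> I" "s \<in> carrier R" for r s
        using l_closed [OF that] hI(2) that by (simp_all add: B.R.m_comm)
    qed
    moreover have "h \<in> module_hom R (ideal_module R I) E"
      using hI(1) G'(2) add mul h_eq by (intro module_homI) auto
    ultimately obtain e where e: "e \<in> carrier E" "\<And>r. r \<in> I \<Longrightarrow> h r = r \<odot>\<^bsub>E\<^esub> e"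
      using baer [of I h] by blast
    have "\<exists>G'. hom_graph R B E G' \<and> G \<subseteq> G' \<and> (b, e) \<in> G'"
    proof (rule hom_graph_adjoin [OF B E G(1) b e(1)])
      show "y = r \<odot>\<^bsub>E\<^esub> e" if "r \<in> carrier R" "(r \<odot>\<^bsub>B\<^esub> b, y) \<in> G" for r y
        using e(2) [OF memI [OF that]] h_eq [OF that(2)] by simp
    qed
    then obtain G1 where "hom_graph R B E G1" "G \<subseteq> G1" "(b, e) \<in> G1"
      by (elim exE conjE)
    \<comment> \<open>By maximality the enlarged graph is \<open>G\<close> itself.\<close>
    with max G(2) have "(b, e) \<in> G"
      by auto
    then show ?thesis ..
  qed
  define \<psi> where "\<psi> b = (THE y. (b, y) \<in> G)" for b
  have \<psi>_eq: "\<psi> b = y" if "(b, y) \<in> G" for b y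
    using that unique by (auto simp: \<psi>_def)
  have \<psi>: "(b, \<psi> b) \<in> G" if "b \<in> carrier B" for b
    using total [OF that] \<psi>_eq by auto
  have "\<psi> \<in> module_hom R B E"
    using G'(2) [OF \<psi>] \<psi>_eq [OF G'(4) [OF \<psi> \<psi>]] \<psi>_eq [OF G'(5) [OF _ \<psi>]]
    by (intro module_homI)
  moreover have "\<forall>(a, y)\<in>G0. \<psi> a = y"
    using G(2) \<psi>_eq by blast
  ultimately show ?thesis by blast
qed

section \<open>Tensor products\<close>

locale tensor = M: module R M + N: module R N
  for R :: "('a, 'r) ring_scheme" and M :: "('a, 'm) module" and N :: "('a, 'n) module"
begin

abbreviation F :: "('m \<times> 'n \<Rightarrow>\<^sub>0 int) monoid" where
  "F \<equiv> free_Abelian_group (carrier M \<times> carrier N)"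

abbreviation K :: "('m \<times> 'n \<Rightarrow>\<^sub>0 int) set" where
  "K \<equiv> tensor_relation_subgroup R M N"

abbreviation T :: "('m \<times> 'n \<Rightarrow>\<^sub>0 int) set monoid" where
  "T \<equiv> tensor_product R M N"

abbreviation pt :: "'m \<Rightarrow> 'n \<Rightarrow> ('m \<times> 'n \<Rightarrow>\<^sub>0 int) set" where
  "pt \<equiv> pure_tensor R M N"

sublocale F: comm_group F
  by (rule abelian_free_Abelian_group)

lemma F_diff_closed: "x \<in> carrier F \<Longrightarrow> y \<in> carrier F \<Longrightarrow> x - y \<in> carrier F"
  using keys_diff [of x y] by auto

lemma relations_closed: "tensor_relations R M N \<subseteq> carrier F"
  unfolding tensor_relations_def
  by (auto simp del: carrier_free_Abelian_group_iff intro!: F_diff_closed)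

lemma subgroup_K: "subgroup K F"
  unfolding tensor_relation_subgroup_def using relations_closed by (rule F.generate_is_subgroup)

sublocale K: normal K F
  using subgroup_K by (simp add: F.normal_iff_subgroup)

sublocale T: comm_group T
  unfolding tensor_product_def using subgroup_K by (rule F.abelian_FactGroup)

lemma relation_in_K: "x \<in> tensor_relations R M N \<Longrightarrow> x \<in> K"
  unfolding tensor_relation_subgroup_def by (rule generate.incl)

lemma coset_hom: "(\<lambda>x. K #>\<^bsub>F\<^esub> x) \<in> hom F T"
  unfolding tensor_product_def by (rule K.r_coset_hom_Mod)

lemma coset_eqI:
  assumes "x \<in> carrier F" "y \<in> carrier F" "x - y \<in> K"
  shows "K #>\<^bsub>F\<^esub> x = K #>\<^bsub>F\<^esub> y"
proof -
  have "(x - y) \<otimes>\<^bsub>F\<^esub> y \<in> K #>\<^bsub>F\<^esub> y"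
    using assms K.subset by (intro F.rcosI)
  then have "x \<in> K #>\<^bsub>F\<^esub> y" by simp
  then show ?thesis
    using F.repr_independence assms(2) subgroup_K by metis
qed

lemma coset_mult:
  assumes "x \<in> carrier F" "y \<in> carrier F"
  shows "(K #>\<^bsub>F\<^esub> x) \<otimes>\<^bsub>T\<^esub> (K #>\<^bsub>F\<^esub> y) = K #>\<^bsub>F\<^esub> (x + y)"
  using hom_mult [OF coset_hom assms] by simp

lemma pure_closed [simp]: "m \<in> carrier M \<Longrightarrow> n \<in> carrier N \<Longrightarrow> pt m n \<in> carrier T"
  unfolding pure_tensor_def
  using hom_in_carrier [OF coset_hom, of "frag_of (m, n)"] by simp

lemma frag_closed: "m \<in> carrier M \<Longrightarrow> n \<in> carrier N \<Longrightarrow> frag_of (m, n) \<in> carrier F"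
  by simp

lemma pure_add_left:
  assumes "m \<in> carrier M" "m' \<in> carrier M" "n \<in> carrier N"
  shows "pt (m \<oplus>\<^bsub>M\<^esub> m') n = pt m n \<otimes>\<^bsub>T\<^esub> pt m' n"
proof -
  have "frag_of (m \<oplus>\<^bsub>M\<^esub> m', n) - frag_of (m, n) - frag_of (m', n) \<in> K"
    using assms by (intro relation_in_K) (auto simp: tensor_relations_def)
  then have "K #>\<^bsub>F\<^esub> frag_of (m \<oplus>\<^bsub>M\<^esub> m', n) = K #>\<^bsub>F\<^esub> (frag_of (m, n) + frag_of (m', n))"
    using assms F.m_closed [OF frag_closed frag_closed]
    by (intro coset_eqI) (auto simp: diff_diff_eq)
  then show ?thesis
    using assms coset_mult [OF frag_closed frag_closed] by (simp add: pure_tensor_def)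
qed

lemma pure_add_right:
  assumes "m \<in> carrier M" "n \<in> carrier N" "n' \<in> carrier N"
  shows "pt m (n \<oplus>\<^bsub>N\<^esub> n') = pt m n \<otimes>\<^bsub>T\<^esub> pt m n'"
proof -
  have "frag_of (m, n \<oplus>\<^bsub>N\<^esub> n') - frag_of (m, n) - frag_of (m, n') \<in> K"
    using assms by (intro relation_in_K) (auto simp: tensor_relations_def)
  then have "K #>\<^bsub>F\<^esub> frag_of (m, n \<oplus>\<^bsub>N\<^esub> n') = K #>\<^bsub>F\<^esub> (frag_of (m, n) + frag_of (m, n'))"
    using assms F.m_closed [OF frag_closed frag_closed]
    by (intro coset_eqI) (auto simp: diff_diff_eq)
  then show ?thesis
    using assms coset_mult [OF frag_closed frag_closed] by (simp add: pure_tensor_def)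
qed

lemma pure_balanced:
  assumes "r \<in> carrier R" "m \<in> carrier M" "n \<in> carrier N"
  shows "pt (r \<odot>\<^bsub>M\<^esub> m) n = pt m (r \<odot>\<^bsub>N\<^esub> n)"
proof -
  have "frag_of (r \<odot>\<^bsub>M\<^esub> m, n) - frag_of (m, r \<odot>\<^bsub>N\<^esub> n) \<in> K"
    using assms by (intro relation_in_K) (auto simp: tensor_relations_def)
  then show ?thesis
    unfolding pure_tensor_def using assms by (intro coset_eqI) auto
qed

text \<open>From 0 = 0 + 0 this tensor is idempotent, and a group has only one idempotent.\<close>

lemma pure_zero_right:
  assumes "m \<in> carrier M"
  shows "pt m \<zero>\<^bsub>N\<^esub> = \<one>\<^bsub>T\<^esub>"
  using pure_add_right [of m "\<zero>\<^bsub>N\<^esub>" "\<zero>\<^bsub>N\<^esub>"] assms by (simp add: T.l_cancel_one')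

text \<open>Every element of \<open>T\<close> is the coset of a formal integer combination of pairs,
  so induction on the free abelian group passes to the quotient. Products with inverses mirror the
  difference step there.\<close>

lemma tensor_induct [consumes 1, case_names one diff pure]:
  assumes t: "t \<in> carrier T"
    and one: "P \<one>\<^bsub>T\<^esub>"
    and diff: "\<And>a b. a \<in> carrier T \<Longrightarrow> b \<in> carrier T \<Longrightarrow> P a \<Longrightarrow> P b \<Longrightarrow> P (a \<otimes>\<^bsub>T\<^esub> inv\<^bsub>T\<^esub> b)"
    and pure: "\<And>m n. m \<in> carrier M \<Longrightarrow> n \<in> carrier N \<Longrightarrow> P (pt m n)"
  shows "P t"
proof -
  interpret q: group_hom F T "\<lambda>x. K #>\<^bsub>F\<^esub> x"
    using coset_hom by (intro group_hom.intro group_hom_axioms.intro F.is_group T.is_group)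
  obtain x where x: "Poly_Mapping.keys x \<subseteq> carrier M \<times> carrier N" "t = K #>\<^bsub>F\<^esub> x"
    using t by (auto simp: tensor_product_def carrier_FactGroup)
  have "P (K #>\<^bsub>F\<^esub> x)"
    using x(1)
  proof (rule free_Abelian_group_induct)
    show "P (K #>\<^bsub>F\<^esub> 0)"
      using one q.hom_one by simp
    show "P (K #>\<^bsub>F\<^esub> frag_of a)" if "a \<in> carrier M \<times> carrier N" for a
      using that pure by (auto simp: pure_tensor_def)
    fix x y
    assume *: "Poly_Mapping.keys x \<subseteq> carrier M \<times> carrier N"
      "Poly_Mapping.keys y \<subseteq> carrier M \<times> carrier N" "P (K #>\<^bsub>F\<^esub> x)" "P (K #>\<^bsub>F\<^esub> y)"
    then have "K #>\<^bsub>F\<^esub> (x - y) = (K #>\<^bsub>F\<^esub> x) \<otimes>\<^bsub>T\<^esub> inv\<^bsub>T\<^esub> (K #>\<^bsub>F\<^esub> y)"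
      using q.hom_mult [of x "inv\<^bsub>F\<^esub> y"] q.hom_inv [of y] F.inv_closed [of y] by simp
    then show "P (K #>\<^bsub>F\<^esub> (x - y))"
      using * diff q.hom_closed by simp
  qed
  then show ?thesis by (simp add: x(2))
qed

lemma tensor_hom_eqI:
  assumes "group G" "h \<in> hom T G" "h' \<in> hom T G"
    and eq: "\<And>m n. m \<in> carrier M \<Longrightarrow> n \<in> carrier N \<Longrightarrow> h (pt m n) = h' (pt m n)"
    and t: "t \<in> carrier T"
  shows "h t = h' t"
proof -
  interpret h: group_hom T G h
    using assms by (intro group_hom.intro group_hom_axioms.intro T.is_group)
  interpret h': group_hom T G h'
    using assms by (intro group_hom.intro group_hom_axioms.intro T.is_group)
  from t show ?thesis
    by (induction t rule: tensor_induct) (simp_all add: eq)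
qed

text \<open>Extend \<open>\<beta>\<close> to the free abelian group. Biadditivity and balance make
  the extension kill the generators of \<open>K\<close>, so it factors through the quotient.\<close>

lemma tensor_universal:
  assumes G: "comm_group G"
    and closed: "\<And>m n. m \<in> carrier M \<Longrightarrow> n \<in> carrier N \<Longrightarrow> \<beta> m n \<in> carrier G"
    and left: "\<And>m m' n. m \<in> carrier M \<Longrightarrow> m' \<in> carrier M \<Longrightarrow> n \<in> carrier N \<Longrightarrow>
      \<beta> (m \<oplus>\<^bsub>M\<^esub> m') n = \<beta> m n \<otimes>\<^bsub>G\<^esub> \<beta> m' n"
    and right: "\<And>m n n'. m \<in> carrier M \<Longrightarrow> n \<in> carrier N \<Longrightarrow> n' \<in> carrier N \<Longrightarrow>
      \<beta> m (n \<oplus>\<^bsub>N\<^esub> n') = \<beta> m n \<otimes>\<^bsub>G\<^esub> \<beta> m n'"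
    and balanced: "\<And>r m n. r \<in> carrier R \<Longrightarrow> m \<in> carrier M \<Longrightarrow> n \<in> carrier N \<Longrightarrow>
      \<beta> (r \<odot>\<^bsub>M\<^esub> m) n = \<beta> m (r \<odot>\<^bsub>N\<^esub> n)"
  obtains h where "h \<in> hom T G"
    and "\<And>m n. m \<in> carrier M \<Longrightarrow> n \<in> carrier N \<Longrightarrow> h (pt m n) = \<beta> m n"
proof -
  interpret G: comm_group G by fact
  have "case_prod \<beta> ` (carrier M \<times> carrier N) \<subseteq> carrier G"
    using closed by auto
  then obtain k where k: "k \<in> hom F G"
    "\<And>x. x \<in> carrier M \<times> carrier N \<Longrightarrow> k (frag_of x) = case_prod \<beta> x"
    using G.free_Abelian_group_universal by blast
  interpret k: group_hom F G k
    using k(1) by (intro group_hom.intro group_hom_axioms.intro F.is_group G.is_group)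
  have k_diff: "k (x - y) = k x \<otimes>\<^bsub>G\<^esub> inv\<^bsub>G\<^esub> k y" if "x \<in> carrier F" "y \<in> carrier F" for x y
    using k.hom_mult [of x "inv\<^bsub>F\<^esub> y"] k.hom_inv [of y] F.inv_closed [of y] that by simp
  have k_frag: "k (frag_of (m, n)) = \<beta> m n" if "m \<in> carrier M" "n \<in> carrier N" for m n
    using k(2) [of "(m, n)"] that by simp
  \<comment> \<open>The form taken by the image of an additivity relation once
    \<open>\<beta>\<close> has been expanded.\<close>
  have cancel: "a \<otimes>\<^bsub>G\<^esub> b \<otimes>\<^bsub>G\<^esub> inv\<^bsub>G\<^esub> a \<otimes>\<^bsub>G\<^esub> inv\<^bsub>G\<^esub> b = \<one>\<^bsub>G\<^esub>" if "a \<in> carrier G" "b \<in> carrier G" for a b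
    using that G.m_comm [of a b] by (simp add: G.m_assoc)
  have "tensor_relations R M N \<subseteq> kernel F G k"
  proof
    fix x assume x: "x \<in> tensor_relations R M N"
    have "k x = \<one>\<^bsub>G\<^esub>"
      using x unfolding tensor_relations_def
      by (auto simp: k_diff k_frag frag_closed F_diff_closed closed left right balanced cancel
        simp del: carrier_free_Abelian_group_iff)
    then show "x \<in> kernel F G k"
      using x relations_closed by (auto simp: kernel_def simp del: carrier_free_Abelian_group_iff)
  qed
  then have "K \<subseteq> kernel F G k"
    unfolding tensor_relation_subgroup_def using k.subgroup_kernel by (rule F.generate_subgroup_incl)
  then obtain h where h: "h \<in> hom (F Mod K) G" "\<And>x. x \<in> carrier F \<Longrightarrow> h (K #>\<^bsub>F\<^esub> x) = k x"
    using k.FactGroup_universal_kernel K.normal_axioms by blast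
  show thesis
  proof
    show "h \<in> hom T G"
      using h(1) by (simp add: tensor_product_def)
    show "h (pt m n) = \<beta> m n" if "m \<in> carrier M" "n \<in> carrier N" for m n
      using that h(2) [OF frag_closed] k_frag by (simp add: pure_tensor_def)
  qed
qed

end

text \<open>\<open>l\<close> is a left action of \<open>R\<close> on \<open>M\<close> commuting with the module structure; the tensor product is
  formed over the latter and made a module through the former.\<close>

definition bimodule_tensor ::
  "('a, 'r) ring_scheme \<Rightarrow> ('a \<Rightarrow> 'm \<Rightarrow> 'm) \<Rightarrow> ('a, 'm) module \<Rightarrow> ('a, 'n) module \<Rightarrow>
    ('a, ('m \<times> 'n \<Rightarrow>\<^sub>0 int) set) module" where
  "bimodule_tensor R l M N = \<lparr>carrier = carrier (tensor_product R M N), monoid.mult = undefined,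
     monoid.one = undefined, ring.zero = \<one>\<^bsub>tensor_product R M N\<^esub>,
     ring.add = monoid.mult (tensor_product R M N),
     smult = (\<lambda>r. SOME h. h \<in> hom (tensor_product R M N) (tensor_product R M N) \<and>
       (\<forall>m\<in>carrier M. \<forall>n\<in>carrier N. h (pure_tensor R M N m n) = pure_tensor R M N (l r m) n))\<rparr>"

lemma bimodule_tensor_simps [simp]:
  "carrier (bimodule_tensor R l M N) = carrier (tensor_product R M N)"
  "\<zero>\<^bsub>bimodule_tensor R l M N\<^esub> = \<one>\<^bsub>tensor_product R M N\<^esub>"
  "x \<oplus>\<^bsub>bimodule_tensor R l M N\<^esub> y = x \<otimes>\<^bsub>tensor_product R M N\<^esub> y"
  by (simp_all add: bimodule_tensor_def)

locale tensor_bimodule = tensor R M N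
  for R :: "('a, 'r) ring_scheme" and M :: "('a, 'm) module" and N :: "('a, 'n) module" +
  fixes l :: "'a \<Rightarrow> 'm \<Rightarrow> 'm"
  assumes l_closed [simp]: "\<And>r m. r \<in> carrier R \<Longrightarrow> m \<in> carrier M \<Longrightarrow> l r m \<in> carrier M"
    and l_add_right: "\<And>r m m'. r \<in> carrier R \<Longrightarrow> m \<in> carrier M \<Longrightarrow> m' \<in> carrier M \<Longrightarrow>
      l r (m \<oplus>\<^bsub>M\<^esub> m') = l r m \<oplus>\<^bsub>M\<^esub> l r m'"
    and l_add_left: "\<And>r s m. r \<in> carrier R \<Longrightarrow> s \<in> carrier R \<Longrightarrow> m \<in> carrier M \<Longrightarrow>
      l (r \<oplus>\<^bsub>R\<^esub> s) m = l r m \<oplus>\<^bsub>M\<^esub> l s m"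
    and l_mult: "\<And>r s m. r \<in> carrier R \<Longrightarrow> s \<in> carrier R \<Longrightarrow> m \<in> carrier M \<Longrightarrow>
      l (r \<otimes>\<^bsub>R\<^esub> s) m = l r (l s m)"
    and l_one: "\<And>m. m \<in> carrier M \<Longrightarrow> l \<one>\<^bsub>R\<^esub> m = m"
    and l_commute: "\<And>r s m. r \<in> carrier R \<Longrightarrow> s \<in> carrier R \<Longrightarrow> m \<in> carrier M \<Longrightarrow>
      l r (s \<odot>\<^bsub>M\<^esub> m) = s \<odot>\<^bsub>M\<^esub> l r m"
begin

abbreviation B where "B \<equiv> bimodule_tensor R l M N"

text \<open>The map (m, n) \<mapsto> \<open>pt (l r m) n\<close> is biadditive, and balanced by
  \<open>l_commute\<close>; the universal property therefore provides an endomorphism that the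
  choice in the definition can pick.\<close>

lemma
  assumes r: "r \<in> carrier R"
  shows smult_hom: "(\<lambda>t. r \<odot>\<^bsub>B\<^esub> t) \<in> hom T T"
    and smult_pure: "\<And>m n. m \<in> carrier M \<Longrightarrow> n \<in> carrier N \<Longrightarrow> r \<odot>\<^bsub>B\<^esub> pt m n = pt (l r m) n"
proof -
  define P where "P = (\<lambda>h. h \<in> hom T T \<and> (\<forall>m\<in>carrier M. \<forall>n\<in>carrier N. h (pt m n) = pt (l r m) n))"
  obtain h where "h \<in> hom T T" "\<And>m n. m \<in> carrier M \<Longrightarrow> n \<in> carrier N \<Longrightarrow> h (pt m n) = pt (l r m) n"
  proof (rule tensor_universal [of T "\<lambda>m n. pt (l r m) n"])
    show "comm_group T" by (rule T.comm_group_axioms)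
  qed (use r in \<open>auto simp: l_add_right l_commute pure_add_left pure_add_right pure_balanced\<close>)
  then have "P h" by (simp add: P_def)
  then have "P (SOME h. P h)" by (rule someI [of P])
  moreover have "(\<odot>\<^bsub>B\<^esub>) r = (SOME h. P h)"
    by (simp add: bimodule_tensor_def P_def)
  ultimately have "P ((\<odot>\<^bsub>B\<^esub>) r)" by (simp only:)
  then show "(\<lambda>t. r \<odot>\<^bsub>B\<^esub> t) \<in> hom T T"
    and "\<And>m n. m \<in> carrier M \<Longrightarrow> n \<in> carrier N \<Longrightarrow> r \<odot>\<^bsub>B\<^esub> pt m n = pt (l r m) n"
    unfolding P_def by blast+
qed

text \<open>The laws for scalars are equalities between endomorphisms of the group \<open>T\<close>,
  hence suffice to be checked on pure tensors, where they are laws of the left action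
  \<open>l\<close>.\<close>

lemma module_bimodule_tensor: "module R B"
proof (rule moduleI)
  show "cring R" by (rule M.R.is_cring)
  show "abelian_group B"
    by (intro abelian_groupI) (auto simp: T.m_ac intro: T.l_inv_ex)
  have closed: "r \<odot>\<^bsub>B\<^esub> t \<in> carrier T" if "r \<in> carrier R" "t \<in> carrier T" for r t
    using hom_in_carrier [OF smult_hom] that by blast
  then show "\<And>r t. r \<in> carrier R \<Longrightarrow> t \<in> carrier B \<Longrightarrow> r \<odot>\<^bsub>B\<^esub> t \<in> carrier B"
    by simp
  show "r \<odot>\<^bsub>B\<^esub> (t \<oplus>\<^bsub>B\<^esub> t') = r \<odot>\<^bsub>B\<^esub> t \<oplus>\<^bsub>B\<^esub> r \<odot>\<^bsub>B\<^esub> t'"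
    if "r \<in> carrier R" "t \<in> carrier B" "t' \<in> carrier B" for r t t'
    using hom_mult [OF smult_hom] that by simp
  show "(r \<oplus>\<^bsub>R\<^esub> s) \<odot>\<^bsub>B\<^esub> t = r \<odot>\<^bsub>B\<^esub> t \<oplus>\<^bsub>B\<^esub> s \<odot>\<^bsub>B\<^esub> t"
    if "r \<in> carrier R" "s \<in> carrier R" "t \<in> carrier B" for r s t
  proof -
    have hom: "(\<lambda>t. (r \<odot>\<^bsub>B\<^esub> t) \<otimes>\<^bsub>T\<^esub> (s \<odot>\<^bsub>B\<^esub> t)) \<in> hom T T"
      using hom_mult [OF smult_hom] closed that
      by (intro homI) (simp_all add: T.m_ac)
    have "(r \<oplus>\<^bsub>R\<^esub> s) \<odot>\<^bsub>B\<^esub> t = (r \<odot>\<^bsub>B\<^esub> t) \<otimes>\<^bsub>T\<^esub> (s \<odot>\<^bsub>B\<^esub> t)"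
      by (rule tensor_hom_eqI [OF T.is_group smult_hom [of "r \<oplus>\<^bsub>R\<^esub> s"] hom])
        (use that in \<open>simp_all add: smult_pure l_add_left pure_add_left\<close>)
    then show ?thesis by simp
  qed
  show "(r \<otimes>\<^bsub>R\<^esub> s) \<odot>\<^bsub>B\<^esub> t = r \<odot>\<^bsub>B\<^esub> (s \<odot>\<^bsub>B\<^esub> t)"
    if "r \<in> carrier R" "s \<in> carrier R" "t \<in> carrier B" for r s t
  proof -
    have hom: "(\<lambda>t. r \<odot>\<^bsub>B\<^esub> (s \<odot>\<^bsub>B\<^esub> t)) \<in> hom T T"
      using hom_mult [OF smult_hom] closed that by (intro homI) simp_all
    show ?thesis
      by (rule tensor_hom_eqI [OF T.is_group smult_hom [of "r \<otimes>\<^bsub>R\<^esub> s"] hom])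
        (use that in \<open>simp_all add: smult_pure l_mult\<close>)
  qed
  show "\<one>\<^bsub>R\<^esub> \<odot>\<^bsub>B\<^esub> t = t" if "t \<in> carrier B" for t
  proof -
    have hom: "(\<lambda>t. t) \<in> hom T T"
      by (intro homI) simp_all
    show ?thesis
      by (rule tensor_hom_eqI [OF T.is_group smult_hom [of "\<one>\<^bsub>R\<^esub>"] hom])
        (use that in \<open>simp_all add: smult_pure l_one\<close>)
  qed
qed

end

section \<open>The bimodule R x as a tensor factor\<close>

context frobenius_ring
begin

abbreviation Rx :: "('a, nat \<Rightarrow> 'a) module" where
  "Rx \<equiv> frob_bimodule_right R p"

abbreviation rx :: "'a \<Rightarrow> nat \<Rightarrow> 'a" where
  "rx r \<equiv> skew_monom R r 1"

lemma skew_monom_eq_iff [simp]: "skew_monom R r n = skew_monom R s n \<longleftrightarrow> r = s"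
  by (metis skew_monom_def)

lemma Rx_simps:
  "carrier Rx = rx ` carrier R"
  "\<zero>\<^bsub>Rx\<^esub> = rx \<zero>"
  "r \<in> carrier R \<Longrightarrow> s \<in> carrier R \<Longrightarrow> rx r \<oplus>\<^bsub>Rx\<^esub> rx s = rx (r \<oplus> s)"
  "r \<in> carrier R \<Longrightarrow> s \<in> carrier R \<Longrightarrow> s \<odot>\<^bsub>Rx\<^esub> rx r = rx (r \<otimes> s [^] p)"
  using skew_monom_mult [of r s p 1 0]
  by (auto simp: frob_bimodule_right_def ring.defs module.defs frob_skew_poly_def skew_monom_def)

text \<open>The scalar s multiplies coefficients by s^p, so distributivity over sums of scalars is
  additivity of Frobenius.\<close>

lemma module_Rx: "module R Rx"
proof (rule moduleI)
  show "abelian_group Rx"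
  proof (rule abelian_groupI)
    show "\<exists>y\<in>carrier Rx. y \<oplus>\<^bsub>Rx\<^esub> x = \<zero>\<^bsub>Rx\<^esub>" if x: "x \<in> carrier Rx" for x
    proof -
      obtain r where r: "r \<in> carrier R" "x = rx r"
        using x by (auto simp: Rx_simps)
      then have "rx (\<ominus> r) \<oplus>\<^bsub>Rx\<^esub> x = \<zero>\<^bsub>Rx\<^esub>"
        by (simp add: Rx_simps l_neg del: One_nat_def)
      then show ?thesis
        using r by (auto simp: Rx_simps simp del: One_nat_def)
    qed
  qed (auto simp: Rx_simps a_ac simp del: One_nat_def)
qed (auto simp: is_cring Rx_simps m_ac l_distr r_distr nat_pow_distrib
    frobenius_add [OF prime_char has_char] simp del: One_nat_def)

text \<open>The left structure of \<open>R x\<close>; the function \<open>t\<close> is \<open>r x\<close> for \<open>r = t 1\<close>.\<close>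

lemma tensor_bimodule_Rx:
  assumes "module R N"
  shows "tensor_bimodule R Rx N (\<lambda>r t. rx (r \<otimes> t 1))"
proof -
  have [simp]: "rx r 1 = r" for r
    by (simp add: skew_monom_def)
  show ?thesis
    by (intro tensor_bimodule.intro tensor.intro tensor_bimodule_axioms.intro module_Rx assms)
      (auto simp: Rx_simps m_ac l_distr r_distr simp del: One_nat_def)
qed

end

section \<open>Socle of the injective envelope\<close>

text \<open>A non-unit generates a proper ideal; an ideal maximal among those containing it but not
  1 is a maximal ideal, hence equal to \<mm>.\<close>

lemma noetherian_local_ring_unit:
  assumes local: "noetherian_local_ring R \<mm>" and r: "r \<in> carrier R" "r \<notin> \<mm>"
  shows "\<exists>s\<in>carrier R. s \<otimes>\<^bsub>R\<^esub> r = \<one>\<^bsub>R\<^esub>"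
proof (rule ccontr)
  assume contra: "\<not> ?thesis"
  interpret R: cring R using local by (simp add: noetherian_local_ring_def)
  interpret R: noetherian_ring R using local by (simp add: noetherian_local_ring_def)
  have "ideal (PIdl\<^bsub>R\<^esub> r) R" "r \<in> PIdl\<^bsub>R\<^esub> r" "\<one>\<^bsub>R\<^esub> \<notin> PIdl\<^bsub>R\<^esub> r"
    using R.cgenideal_ideal R.cgenideal_self r(1) contra by (auto simp: cgenideal_def)
  then have ne: "{J. ideal J R \<and> r \<in> J \<and> \<one>\<^bsub>R\<^esub> \<notin> J} \<noteq> {}"
    by blast
  have "\<exists>J\<in>{J. ideal J R \<and> r \<in> J \<and> \<one>\<^bsub>R\<^esub> \<notin> J}.
      \<forall>X\<in>{J. ideal J R \<and> r \<in> J \<and> \<one>\<^bsub>R\<^esub> \<notin> J}. J \<subseteq> X \<longrightarrow> X = J"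
  proof (rule subset_Zorn_nonempty [OF ne])
    fix \<C> assume C: "\<C> \<noteq> {}" "subset.chain {J. ideal J R \<and> r \<in> J \<and> \<one>\<^bsub>R\<^esub> \<notin> J} \<C>"
    then have "subset.chain {J. ideal J R} \<C>"
      by (auto simp: subset_chain_def)
    \<comment> \<open>In a Noetherian ring a nonempty chain of ideals has a largest member.\<close>
    then have "\<Union>\<C> \<in> \<C>"
      using C(1) by (intro R.ideal_chain_is_trivial)
    then show "\<Union>\<C> \<in> {J. ideal J R \<and> r \<in> J \<and> \<one>\<^bsub>R\<^esub> \<notin> J}"
      using C(2) unfolding subset_chain_def by blast
  qed
  then obtain J where J: "ideal J R" "r \<in> J" "\<one>\<^bsub>R\<^esub> \<notin> J"
    and max: "\<And>X. ideal X R \<Longrightarrow> r \<in> X \<Longrightarrow> \<one>\<^bsub>R\<^esub> \<notin> X \<Longrightarrow> J \<subseteq> X \<Longrightarrow> X = J"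
    by auto
  have "maximalideal J R"
  proof (rule maximalidealI [OF J(1)])
    show "carrier R \<noteq> J" using J(3) by auto
    show "X = J \<or> X = carrier R" if "ideal X R" "J \<subseteq> X" "X \<subseteq> carrier R" for X
      using that J(2) max [OF that(1)] ideal.one_imp_carrier by blast
  qed
  then have "J = \<mm>"
    using local by (simp add: noetherian_local_ring_def)
  with J(2) r(2) show False by simp
qed

text \<open>The image \<open>u\<close> of \<open>1\<close> spans the copy of the residue field, which is the smallest nonzero
  submodule of \<open>E\<close>.\<close>

lemma injective_envelope_socle:
  fixes R :: "('a, 'r) ring_scheme" and E :: "('a, 'e) module"
  assumes local: "noetherian_local_ring R \<mm>"
    and env: "injective_envelope U R (quotient_module R \<mm>) E \<iota>"
  obtains u where "u \<in> carrier E" "u \<noteq> \<zero>\<^bsub>E\<^esub>" "\<forall>r\<in>\<mm>. r \<odot>\<^bsub>E\<^esub> u = \<zero>\<^bsub>E\<^esub>"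
    "\<And>L. submodule L R E \<Longrightarrow> L \<noteq> {\<zero>\<^bsub>E\<^esub>} \<Longrightarrow> u \<in> L"
proof -
  define Q where "Q = quotient_module R \<mm>"
  have Q: "module R Q" and E: "module R E" and ess: "essential_embedding R Q E \<iota>"
    using env by (simp_all add: injective_envelope_def injective_module_def Q_def)
  interpret Q: module R Q by fact
  interpret E: module R E by fact
  interpret m: maximalideal \<mm> R
    using local by (simp add: noetherian_local_ring_def)
  have m_carrier: "\<mm> \<subseteq> carrier R"
    by (rule m.a_subset)
  have cQ: "carrier Q = (\<lambda>r. \<mm> +>\<^bsub>R\<^esub> r) ` carrier R" and zQ: "\<zero>\<^bsub>Q\<^esub> = \<mm>"
    by (auto simp: Q_def quotient_module_def ring.defs module.defs FactRing_def A_RCOSETS_def')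
  have sQ: "r \<odot>\<^bsub>Q\<^esub> (\<mm> +>\<^bsub>R\<^esub> \<one>\<^bsub>R\<^esub>) = \<mm> +>\<^bsub>R\<^esub> r" if "r \<in> carrier R" for r
    using that m.rcoset_mult_add [of r "\<one>\<^bsub>R\<^esub>"]
    by (simp add: Q_def quotient_module_def ring.defs module.defs FactRing_def)
  have \<iota>: "\<iota> \<in> module_hom R Q E" "inj_on \<iota> (carrier Q)"
    using ess by (simp_all add: essential_embedding_def)
  note \<iota>_hom = module_homD [OF \<iota>(1)]
  have \<iota>_zero: "\<iota> \<mm> = \<zero>\<^bsub>E\<^esub>"
    using module_hom_zero [OF Q E \<iota>(1)] by (simp add: zQ)
  define u where "u = \<iota> (\<mm> +>\<^bsub>R\<^esub> \<one>\<^bsub>R\<^esub>)"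
  have one: "\<mm> +>\<^bsub>R\<^esub> \<one>\<^bsub>R\<^esub> \<in> carrier Q"
    by (simp add: cQ)
  have smult_u: "r \<odot>\<^bsub>E\<^esub> u = \<iota> (\<mm> +>\<^bsub>R\<^esub> r)" if "r \<in> carrier R" for r
    using \<iota>_hom(3) [OF that one] sQ [OF that] by (simp add: u_def)
  show thesis
  proof
    show u: "u \<in> carrier E"
      using \<iota>_hom(1) [OF one] by (simp add: u_def)
    have "\<mm> +>\<^bsub>R\<^esub> \<one>\<^bsub>R\<^esub> \<noteq> \<mm>"
    proof
      assume "\<mm> +>\<^bsub>R\<^esub> \<one>\<^bsub>R\<^esub> = \<mm>"
      then have "\<one>\<^bsub>R\<^esub> \<in> \<mm>"
        using m.a_rcos_self [of "\<one>\<^bsub>R\<^esub>"] by simp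
      then show False
        using m.one_imp_carrier m.I_notcarr by simp
    qed
    then show "u \<noteq> \<zero>\<^bsub>E\<^esub>"
      using inj_onD [OF \<iota>(2), of "\<mm> +>\<^bsub>R\<^esub> \<one>\<^bsub>R\<^esub>" \<mm>] one Q.M.zero_closed \<iota>_zero
      by (auto simp: u_def zQ)
    show "\<forall>r\<in>\<mm>. r \<odot>\<^bsub>E\<^esub> u = \<zero>\<^bsub>E\<^esub>"
      using m_carrier smult_u m.a_rcos_const \<iota>_zero by auto
    fix L assume L: "submodule L R E" "L \<noteq> {\<zero>\<^bsub>E\<^esub>}"
    interpret L: submodule L R E by fact
    have ne: "L \<inter> \<iota> ` carrier Q \<noteq> {\<zero>\<^bsub>E\<^esub>}"
      using ess L by (simp add: essential_embedding_def)
    have mem: "\<zero>\<^bsub>E\<^esub> \<in> L \<inter> \<iota> ` carrier Q"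
    proof
      show "\<zero>\<^bsub>E\<^esub> \<in> L"
        using L.one_closed by simp
      show "\<zero>\<^bsub>E\<^esub> \<in> \<iota> ` carrier Q"
        using imageI [OF Q.M.zero_closed, of \<iota>] \<iota>_zero zQ by simp
    qed
    have pick: "\<exists>x\<in>A. x \<noteq> z" if "A \<noteq> {z}" "z \<in> A" for A and z :: 'e
      using that by blast
    \<comment> \<open>Essentiality supplies a nonzero element of \<open>L\<close> of the form r u.
      Since \<mm> kills u, r lies outside \<mm> and is a unit, and dividing by it brings u into
      \<open>L\<close>.\<close>
    obtain e where e: "e \<in> L" "e \<in> \<iota> ` carrier Q" "e \<noteq> \<zero>\<^bsub>E\<^esub>"
      using pick [OF ne mem] by (elim bexE IntE)
    then obtain r where r: "r \<in> carrier R" "e = r \<odot>\<^bsub>E\<^esub> u"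
      using smult_u by (auto simp: cQ)
    with e(3) have "r \<notin> \<mm>"
      using smult_u [of r] m.a_rcos_const [of r] \<iota>_zero by auto
    then obtain s where s: "s \<in> carrier R" "s \<otimes>\<^bsub>R\<^esub> r = \<one>\<^bsub>R\<^esub>"
      using noetherian_local_ring_unit [OF local r(1)] by blast
    have "s \<odot>\<^bsub>E\<^esub> e = u"
      using E.smult_assoc1 [OF s(1) r(1) u] s(2) r(2) u by simp
    then show "u \<in> L"
      using L.smult_closed [OF s(1) e(1)] by simp
  qed
qed

text \<open>The assignment r g \<mapsto> r u is well defined on R g: the annihilator of g lies in
  \<mm>, as no unit kills g, and \<mm> kills u. Baer's criterion extends it to \<open>N\<close>,
  whatever the type of \<open>N\<close>.\<close>

lemma injective_envelope_cogenerator: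
  fixes R :: "('a, 'r) ring_scheme" and E :: "('a, 'e) module" and N :: "('a, 'n) module"
  assumes local: "noetherian_local_ring R \<mm>"
    and E: "injective_module TYPE('u) R E" and f: "inj_on (f :: 'a \<Rightarrow> 'u) (carrier R)"
    and u: "u \<in> carrier E" "\<forall>r\<in>\<mm>. r \<odot>\<^bsub>E\<^esub> u = \<zero>\<^bsub>E\<^esub>"
    and N: "module R N" and g: "g \<in> carrier N" "g \<noteq> \<zero>\<^bsub>N\<^esub>"
  shows "\<exists>\<phi>\<in>module_hom R N E. \<phi> g = u"
proof -
  have mE: "module R E"
    using E by (simp add: injective_module_def)
  interpret E: module R E by fact
  interpret N: module R N by fact
  let ?G = "{(r \<odot>\<^bsub>N\<^esub> g, r \<odot>\<^bsub>E\<^esub> u) | r. r \<in> carrier R}"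
  have mem: "(r \<odot>\<^bsub>N\<^esub> g, r \<odot>\<^bsub>E\<^esub> u) \<in> ?G" if "r \<in> carrier R" for r
    using that by blast
  have "hom_graph R N E ?G"
    unfolding hom_graph_def
  proof (intro conjI allI impI ballI)
    show "?G \<subseteq> carrier N \<times> carrier E"
      using g u by auto
    show "(\<zero>\<^bsub>N\<^esub>, \<zero>\<^bsub>E\<^esub>) \<in> ?G"
      using mem [of "\<zero>\<^bsub>R\<^esub>"] g u by simp
    show "(a \<oplus>\<^bsub>N\<^esub> b, y \<oplus>\<^bsub>E\<^esub> z) \<in> ?G" if ab: "(a, y) \<in> ?G \<and> (b, z) \<in> ?G" for a y b z
    proof -
      obtain r s where "r \<in> carrier R" "s \<in> carrier R"
        "a = r \<odot>\<^bsub>N\<^esub> g" "y = r \<odot>\<^bsub>E\<^esub> u" "b = s \<odot>\<^bsub>N\<^esub> g" "z = s \<odot>\<^bsub>E\<^esub> u"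
        using ab by blast
      then show ?thesis
        using mem [of "r \<oplus>\<^bsub>R\<^esub> s"] g u by (simp add: N.smult_l_distr E.smult_l_distr)
    qed
    show "(s \<odot>\<^bsub>N\<^esub> a, s \<odot>\<^bsub>E\<^esub> y) \<in> ?G" if s: "s \<in> carrier R" and a: "(a, y) \<in> ?G" for s a y
    proof -
      obtain r where "r \<in> carrier R" "a = r \<odot>\<^bsub>N\<^esub> g" "y = r \<odot>\<^bsub>E\<^esub> u"
        using a by blast
      then show ?thesis
        using mem [of "s \<otimes>\<^bsub>R\<^esub> r"] s g u by (simp add: N.smult_assoc1 E.smult_assoc1)
    qed
    show "y = \<zero>\<^bsub>E\<^esub>" if y: "(\<zero>\<^bsub>N\<^esub>, y) \<in> ?G" for y
    proof -
      obtain r where r: "r \<in> carrier R" "r \<odot>\<^bsub>N\<^esub> g = \<zero>\<^bsub>N\<^esub>" "y = r \<odot>\<^bsub>E\<^esub> u"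
        using y by auto
      have "r \<in> \<mm>"
      proof (rule ccontr)
        assume "r \<notin> \<mm>"
        then obtain s where s: "s \<in> carrier R" "s \<otimes>\<^bsub>R\<^esub> r = \<one>\<^bsub>R\<^esub>"
          using noetherian_local_ring_unit [OF local r(1)] by blast
        then show False
          using N.smult_assoc1 [OF s(1) r(1) g(1)] r(2) g by simp
      qed
      then show ?thesis using u(2) r(3) by simp
    qed
  qed
  with N mE injective_module_imp_baer [OF E f]
  have "\<exists>\<psi>\<in>module_hom R N E. \<forall>(a, y)\<in>?G. \<psi> a = y"
    by (rule baer_extension)
  then obtain \<psi> where \<psi>: "\<psi> \<in> module_hom R N E" "\<forall>(a, y)\<in>?G. \<psi> a = y"
    by (elim bexE)
  have "(g, u) \<in> ?G"
    using mem [of "\<one>\<^bsub>R\<^esub>"] g u by simp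
  from bspec [OF \<psi>(2) this] have "\<psi> g = u"
    by simp
  with \<psi>(1) show ?thesis
    by blast
qed

section \<open>Purity and torsion-freeness\<close>

context frobenius_ring
begin

lemma torsion_free_imp_inj_pure_tensor:
  assumes E: "module R E" and H: "extends_to_skew_module R p E H" and tf: "x_torsion_free R p H"
    and N: "module R N"
    and cogen: "\<And>g. g \<in> carrier N \<Longrightarrow> g \<noteq> \<zero>\<^bsub>N\<^esub> \<Longrightarrow> \<exists>\<phi>\<in>module_hom R N E. \<phi> g \<noteq> \<zero>\<^bsub>E\<^esub>"
  shows "inj_on (pure_tensor R Rx N (skew_X R)) (carrier N)"
proof -
  interpret E: module R E by fact
  interpret N: module R N by fact
  interpret H: left_module "frob_skew_poly R p" H
    using H by (simp add: extends_to_skew_module_def)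
  interpret t: tensor R Rx N
    using module_Rx N by (rule tensor.intro)
  have cH: "carrier H = carrier E" "\<zero>\<^bsub>H\<^esub> = \<zero>\<^bsub>E\<^esub>"
    and aH: "\<And>g h. g \<in> carrier E \<Longrightarrow> h \<in> carrier E \<Longrightarrow> g \<oplus>\<^bsub>H\<^esub> h = g \<oplus>\<^bsub>E\<^esub> h"
    and sH: "\<And>r h. r \<in> carrier R \<Longrightarrow> h \<in> carrier E \<Longrightarrow> skew_monom R r 0 \<odot>\<^bsub>H\<^esub> h = r \<odot>\<^bsub>E\<^esub> h"
    using H by (auto simp: extends_to_skew_module_def)
  have monom [simp]: "skew_monom R r n \<in> carrier (frob_skew_poly R p)" if "r \<in> carrier R" for r n
    using that by (auto simp: skew_poly_simps skew_monom_def up_def)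
  define X where "X h = skew_X R \<odot>\<^bsub>H\<^esub> h" for h
  have X_closed [simp]: "X h \<in> carrier E" if "h \<in> carrier E" for h
    using H.smult_closed [of "skew_X R" h] that by (simp add: X_def cH del: One_nat_def)
  have X_add: "X (g \<oplus>\<^bsub>E\<^esub> h) = X g \<oplus>\<^bsub>E\<^esub> X h" if "g \<in> carrier E" "h \<in> carrier E" for g h
    using H.smult_r_distr [of "skew_X R" g h] that X_closed
    by (simp add: X_def cH aH del: One_nat_def)
  have X_smult: "X (r \<odot>\<^bsub>E\<^esub> h) = (r [^] p) \<odot>\<^bsub>E\<^esub> X h" if r: "r \<in> carrier R" and h: "h \<in> carrier E" for r h
  proof -
    have "X (r \<odot>\<^bsub>E\<^esub> h) = (skew_X R \<otimes>\<^bsub>frob_skew_poly R p\<^esub> skew_monom R r 0) \<odot>\<^bsub>H\<^esub> h"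
      using H.smult_assoc [of "skew_X R" "skew_monom R r 0" h] r h
      by (simp add: X_def sH cH del: One_nat_def)
    \<comment> \<open>The defining relation x r = r^p x, with both sides computed as
      monomials.\<close>
    also have "skew_X R \<otimes>\<^bsub>frob_skew_poly R p\<^esub> skew_monom R r 0
        = skew_monom R (r [^] p) 0 \<otimes>\<^bsub>frob_skew_poly R p\<^esub> skew_X R"
      using skew_monom_mult [of \<one> r p 1 0] skew_monom_mult [of "r [^] p" \<one> p 0 1] r by simp
    also have "\<dots> \<odot>\<^bsub>H\<^esub> h = (r [^] p) \<odot>\<^bsub>E\<^esub> X h"
      using H.smult_assoc [of "skew_monom R (r [^] p) 0" "skew_X R" h] r h X_closed [OF h]
      by (simp add: X_def sH cH del: One_nat_def)
    finally show ?thesis .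
  qed
  have X_inj: "h = \<zero>\<^bsub>E\<^esub>" if h: "h \<in> carrier E" "X h = \<zero>\<^bsub>E\<^esub>" for h
  proof -
    have "skew_X R [^]\<^bsub>frob_skew_poly R p\<^esub> (1::nat) = skew_X R"
      using monom [of \<one> 1] H.S.nat_pow_eone by simp
    then have "h \<in> x_torsion R p H"
      unfolding x_torsion_def using h by (auto simp: cH X_def intro!: exI [of _ "1::nat"])
    then show ?thesis
      using tf by (simp add: x_torsion_free_def cH)
  qed
  show ?thesis
  proof (rule inj_onI, rule ccontr)
    fix g g'
    assume g: "g \<in> carrier N" "g' \<in> carrier N" "g \<noteq> g'"
      and eq: "pure_tensor R Rx N (skew_X R) g = pure_tensor R Rx N (skew_X R) g'"
    \<comment> \<open>The cogenerator property separates elements from zero, so it is applied to the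
      difference of \<open>g\<close> and \<open>g'\<close>.\<close>
    then obtain \<phi> where \<phi>: "\<phi> \<in> module_hom R N E" "\<phi> (g \<ominus>\<^bsub>N\<^esub> g') \<noteq> \<zero>\<^bsub>E\<^esub>"
      using cogen [of "g \<ominus>\<^bsub>N\<^esub> g'"] N.minus_eq_zeroD [of g g'] by auto
    note \<phi>_hom = module_homD [OF \<phi>(1)]
    have [simp]: "rx r 1 = r" for r
      by (simp add: skew_monom_def)
    \<comment> \<open>Here \<open>m 1\<close> is the coefficient r of m = r x. Balance holds because
      r s^p X (\<phi> n) = r X (\<phi> (s n)).\<close>
    obtain h where h: "h \<in> hom (tensor_product R Rx N) (add_monoid E)"
      "\<And>m n. m \<in> carrier Rx \<Longrightarrow> n \<in> carrier N \<Longrightarrow>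
        h (pure_tensor R Rx N m n) = m 1 \<odot>\<^bsub>E\<^esub> X (\<phi> n)"
    proof (rule t.tensor_universal [of "add_monoid E" "\<lambda>m n. m 1 \<odot>\<^bsub>E\<^esub> X (\<phi> n)"])
      show "comm_group (add_monoid E)" by (rule E.M.a_comm_group)
    qed (auto simp: Rx_simps \<phi>_hom X_add X_smult E.smult_l_distr E.smult_r_distr E.smult_assoc1
        simp del: One_nat_def)
    have "X (\<phi> n) = h (pure_tensor R Rx N (skew_X R) n)" if "n \<in> carrier N" for n
      using h(2) [of "skew_X R" n] that by (simp add: Rx_simps \<phi>_hom del: One_nat_def)
    then have "X (\<phi> g) = X (\<phi> g')"
      using g eq by simp
    moreover have "X (\<phi> g) = X (\<phi> (g \<ominus>\<^bsub>N\<^esub> g')) \<oplus>\<^bsub>E\<^esub> X (\<phi> g')"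
    proof -
      have "g = (g \<ominus>\<^bsub>N\<^esub> g') \<oplus>\<^bsub>N\<^esub> g'"
        using g by (simp add: a_minus_def N.M.a_assoc N.M.l_neg)
      then show ?thesis
        using g \<phi>_hom X_add by (metis N.minus_closed)
    qed
    ultimately have "X (\<phi> (g \<ominus>\<^bsub>N\<^esub> g')) = \<zero>\<^bsub>E\<^esub>"
      using g \<phi>_hom(1) by (metis E.M.add.r_cancel_one' N.minus_closed X_closed)
    then show False
      using X_inj \<phi>(2) \<phi>_hom(1) g by simp
  qed
qed

text \<open>\<open>E\<close> enters through an embedding \<open>f\<close> into a module
  \<open>N\<close> for which purity is known, so that \<open>N\<close> can be a copy of
  \<open>E\<close> in the chosen universe. The property \<open>cogen\<close> is required at the type
  of R x \<otimes> N, since a map from that tensor product to \<open>E\<close> is what defines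
  \<open>X\<close>.\<close>

lemma pure_imp_torsion_free_extension:
  fixes E :: "('a, 'e) module" and N :: "('a, 'n) module"
  assumes E: "module R E" and N: "module R N"
    and f: "f \<in> module_hom R E N" "inj_on f (carrier E)"
    and pure: "inj_on (pure_tensor R Rx N (skew_X R)) (carrier N)"
    and u: "u \<in> carrier E" "u \<noteq> \<zero>\<^bsub>E\<^esub>"
    and socle: "\<And>L. submodule L R E \<Longrightarrow> L \<noteq> {\<zero>\<^bsub>E\<^esub>} \<Longrightarrow> u \<in> L"
    and cogen: "\<And>(M :: ('a, ((nat \<Rightarrow> 'a) \<times> 'n \<Rightarrow>\<^sub>0 int) set) module) g.
      module R M \<Longrightarrow> g \<in> carrier M \<Longrightarrow> g \<noteq> \<zero>\<^bsub>M\<^esub> \<Longrightarrow> \<exists>\<phi>\<in>module_hom R M E. \<phi> g = u"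
  shows "\<exists>H :: (nat \<Rightarrow> 'a, 'e) module. extends_to_skew_module R p E H \<and> x_torsion_free R p H"
proof -
  interpret E: module R E by fact
  interpret N: module R N by fact
  interpret t: tensor_bimodule R Rx N "\<lambda>r t. rx (r \<otimes> t 1)"
    using N by (rule tensor_bimodule_Rx)
  note f_hom = module_homD [OF f(1)]
  have x [simp]: "skew_X R \<in> carrier Rx"
    by (simp add: Rx_simps del: One_nat_def)
  have "f u \<noteq> \<zero>\<^bsub>N\<^esub>"
    using u inj_onD [OF f(2), of u "\<zero>\<^bsub>E\<^esub>"] module_hom_zero [OF E N f(1)] by auto
  then have "t.pt (skew_X R) (f u) \<noteq> \<zero>\<^bsub>t.B\<^esub>"
    using inj_onD [OF pure, of "f u" "\<zero>\<^bsub>N\<^esub>"] t.pure_zero_right [OF x] f_hom(1) u by auto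
  then obtain \<psi> where \<psi>: "\<psi> \<in> module_hom R t.B E" "\<psi> (t.pt (skew_X R) (f u)) = u"
    using cogen [OF t.module_bimodule_tensor, of "t.pt (skew_X R) (f u)"] u f_hom(1) x
    by (auto simp del: One_nat_def)
  note \<psi>_hom = module_homD [OF \<psi>(1), unfolded bimodule_tensor_simps]
  define X where "X e = \<psi> (t.pt (skew_X R) (f e))" for e
  have "frobenius_action R p E X"
  proof (intro frobenius_action.intro frobenius_action_axioms.intro frobenius_ring_axioms E)
    show "X e \<in> carrier E" if "e \<in> carrier E" for e
      using that f_hom(1) by (simp add: X_def \<psi>_hom del: One_nat_def)
    show "X (e \<oplus>\<^bsub>E\<^esub> e') = X e \<oplus>\<^bsub>E\<^esub> X e'" if "e \<in> carrier E" "e' \<in> carrier E" for e e'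
      using that by (simp add: X_def f_hom t.pure_add_right \<psi>_hom del: One_nat_def)
    show "X (r \<odot>\<^bsub>E\<^esub> e) = (r [^] p) \<odot>\<^bsub>E\<^esub> X e" if r: "r \<in> carrier R" and e: "e \<in> carrier E" for r e
    proof -
      have "r \<odot>\<^bsub>Rx\<^esub> skew_X R = rx (r [^] p)"
        using Rx_simps(4) [of \<one> r] r by simp
      \<comment> \<open>The scalar crosses the tensor sign to the right action on R x, turns into
        r^p there, and leaves as a left scalar.\<close>
      then have "t.pt (skew_X R) (f (r \<odot>\<^bsub>E\<^esub> e)) = t.pt (rx (r [^] p)) (f e)"
        using t.pure_balanced [OF r x, of "f e"] r e by (simp add: f_hom del: One_nat_def)
      also have "\<dots> = (r [^] p) \<odot>\<^bsub>t.B\<^esub> t.pt (skew_X R) (f e)"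
        using t.smult_pure [of "r [^] p" "skew_X R" "f e"] r e f_hom(1) x
        by (simp add: skew_monom_def)
      finally show ?thesis
        using r e by (simp add: X_def f_hom \<psi>_hom del: One_nat_def)
    qed
  qed
  then interpret X: frobenius_action R p E X .
  have X_zero: "X \<zero>\<^bsub>E\<^esub> = \<zero>\<^bsub>E\<^esub>"
    using X.X_pow_zero [of 1] by simp
  \<comment> \<open>The kernel of \<open>X\<close> is a submodule that misses \<open>u\<close>,
    because X u = u; the socle property then forces it to be zero.\<close>
  let ?L = "{e \<in> carrier E. X e = \<zero>\<^bsub>E\<^esub>}"
  have smult_L: "r \<odot>\<^bsub>E\<^esub> e \<in> ?L" if "r \<in> carrier R" "e \<in> ?L" for r e
    using that by (simp add: X.X_smult)
  have "submodule ?L R E"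
  proof (rule E.submoduleI)
    show "\<ominus>\<^bsub>E\<^esub> e \<in> ?L" if "e \<in> ?L" for e
      using smult_L [of "\<ominus> \<one>" e] that by (simp add: E.smult_l_minus)
  qed (use smult_L in \<open>auto simp: X_zero X.X_add\<close>)
  moreover have "u \<notin> ?L"
    using \<psi>(2) u(2) by (simp add: X_def)
  ultimately have "?L = {\<zero>\<^bsub>E\<^esub>}"
    using socle by blast
  then have "x_torsion_free R p (skew_module R E X)"
    by (intro X.x_torsion_free_skew_module) blast
  then show ?thesis
    using X.extends_to_skew_module_skew_module by blast
qed

end

section \<open>The equivalence for the injective envelope of the residue field\<close>

theorem theorem3p2:
  fixes R :: "'a ring" and \<mm> :: "'a set" and p :: nat
    and E :: "('a, 'e) module" and \<iota> :: "'a set \<Rightarrow> 'e"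
  assumes "normalization_semidom_class.prime p"
    and "noetherian_local_ring R \<mm>"
    and "has_characteristic R p"
    and "injective_envelope TYPE('a + 'e + 'n) R (quotient_module R \<mm>) E \<iota>"
  shows "F_pure TYPE('a + 'e + 'n) R p \<longleftrightarrow>
    (\<exists>H :: (nat \<Rightarrow> 'a, 'e) module. extends_to_skew_module R p E H \<and> x_torsion_free R p H)"
proof -
  have "cring R"
    using assms(2) by (simp add: noetherian_local_ring_def)
  then interpret frobenius_ring R p
    using assms(1,3) by (intro frobenius_ring.intro frobenius_ring_axioms.intro)
  have inj: "injective_module TYPE('a + 'e + 'n) R E"
    using assms(4) by (simp add: injective_envelope_def)
  then have E: "module R E"
    by (simp add: injective_module_def)
  obtain u where u: "u \<in> carrier E" "u \<noteq> \<zero>\<^bsub>E\<^esub>" "\<forall>r\<in>\<mm>. r \<odot>\<^bsub>E\<^esub> u = \<zero>\<^bsub>E\<^esub>"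
    "\<And>L. submodule L R E \<Longrightarrow> L \<noteq> {\<zero>\<^bsub>E\<^esub>} \<Longrightarrow> u \<in> L"
    using injective_envelope_socle [OF assms(2,4)] by blast
  \<comment> \<open>The summand \<open>'a\<close> of the universe holds a copy of \<open>R\<close>,
    which is what Baer's criterion asks for. The tested module keeps an arbitrary type: one
    direction uses the tensor product, the other the modules of the universe.\<close>
  note cogen = injective_envelope_cogenerator [OF assms(2) inj inj_Inl [THEN inj_on_subset, OF subset_UNIV] u(1,3)]
  show ?thesis
  proof
    assume pure: "F_pure TYPE('a + 'e + 'n) R p"
    \<comment> \<open>The middle summand receives the copy of \<open>E\<close> to which F-purity is
      applied.\<close>
    define f :: "'e \<Rightarrow> 'a + 'e + 'n" where "f = (\<lambda>e. Inr (Inl e))"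
    have f: "inj_on f (carrier E)"
      by (simp add: f_def inj_on_def)
    have inj_pure: "inj_on (pure_tensor R Rx (transport_module E f) (skew_X R)) (carrier (transport_module E f))"
      using pure module_transport [OF E f] unfolding F_pure_def by blast
    show "\<exists>H :: (nat \<Rightarrow> 'a, 'e) module. extends_to_skew_module R p E H \<and> x_torsion_free R p H"
      by (rule pure_imp_torsion_free_extension [OF E module_transport [OF E f] transport_hom [OF E f] f
        inj_pure u(1,2)]) (fact u(4), fact cogen)
  next
    assume "\<exists>H :: (nat \<Rightarrow> 'a, 'e) module. extends_to_skew_module R p E H \<and> x_torsion_free R p H"
    then obtain H :: "(nat \<Rightarrow> 'a, 'e) module"
      where H: "extends_to_skew_module R p E H" "x_torsion_free R p H" by blast
    show "F_pure TYPE('a + 'e + 'n) R p"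
      unfolding F_pure_def
    proof (intro allI impI)
      fix N :: "('a, 'a + 'e + 'n) module"
      assume N: "module R N"
      show "inj_on (pure_tensor R Rx N (skew_X R)) (carrier N)"
        by (rule torsion_free_imp_inj_pure_tensor [OF E H N]) (use cogen [OF N] u(2) in blast)
    qed
  qed
qed

end
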